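(* Four profiles are necessary and sufficient for $\Gamma_b$ to be a smooth embedding for some choice of smooth profiles. That is: (a) if $b=(b_1,\dots,b_m):\mathbb T^3\to\mathbb R^m$ is smooth and $\Gamma_b$ is a smooth embedding, then $m\ge4$. (b) Fix $0<r<R$ and $L>R+r$ and set, with $x=(x_1,x_2,x_3)\in\mathbb T^3$, $$\begin{aligned}b_1(x)&=L+(R+r\cos x_3)\cos x_1,& b_2(x)&=(R+r\cos x_3)\sin x_1,\\ b_3(x)&=(R+r\sin x_3)\cos x_2,& b_4(x)&=(R+r\sin x_3)\sin x_2.\end{aligned}$$ Then, with $b=(b_1,b_2,b_3,b_4)$, $\Gamma_b$ is a smooth embedding, and these four profiles are cubically saturating.
   Context: $\mathbb T^3=(\mathbb R/2\pi\mathbb Z)^3$. For smooth $b=(b_1,\dots,b_m):\mathbb T^3\to\mathbb R^m$, $\Gamma_b:\mathbb T^3\to\operatorname{Sym}_m$ is the map $\Gamma_b(x)=b(x)b(x)^{\mathsf T}$ into real symmetric $m\times m$ matrices. Cubic saturation: set $\mathcal S_0=\{b_1,\dots,b_m\}$, $\mathcal S_{n+1}=\mathcal S_n\cup\{\phi b_jb_k:\phi\in\mathcal S_n,\ 1\le j,k\le m\}$, $\mathcal S_\infty=\operatorname{span}_{\mathbb R}\bigcup_{n\ge0}\mathcal S_n$. The profiles are cubically saturating if $\mathcal S_\infty$ is dense in the real Sobolev space $H^1(\mathbb T^3)$. *)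

theory Defs
  imports "HOL-Analysis.Analysis" "HOL-Library.Function_Algebras"
begin

section \<open>The torus\<close>

quotient_type circle = real / "\<lambda>x y. \<exists>k::int. x - y = 2 * pi * of_int k"
  morphisms rep_circle circle_of
proof (rule equivpI)
  show "reflp (\<lambda>x y. \<exists>k::int. x - y = 2 * pi * of_int k)"
    by (rule reflpI, rule exI[of _ 0]) simp
  show "symp (\<lambda>x y. \<exists>k::int. x - y = 2 * pi * of_int k)"
  proof (rule sympI)
    fix x y :: real assume "\<exists>k::int. x - y = 2 * pi * of_int k"
    then obtain k :: int where "x - y = 2 * pi * of_int k" ..
    then show "\<exists>k::int. y - x = 2 * pi * of_int k"
      by (intro exI[of _ "-k"]) (simp add: algebra_simps)
  qed
  show "transp (\<lambda>x y. \<exists>k::int. x - y = 2 * pi * of_int k)"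
  proof (rule transpI)
    fix x y z :: real
    assume "\<exists>k::int. x - y = 2 * pi * of_int k" "\<exists>k::int. y - z = 2 * pi * of_int k"
    then obtain k l :: int where "x - y = 2 * pi * of_int k" "y - z = 2 * pi * of_int l"
      by blast
    then show "\<exists>k::int. x - z = 2 * pi * of_int k"
      by (intro exI[of _ "k + l"]) (simp add: algebra_simps)
  qed
qed

text \<open>The topology is the quotient topology; \<open>circle ^ 3\<close> then carries the product topology.\<close>

instantiation circle :: topological_space
begin

definition open_circle :: "circle set \<Rightarrow> bool"
  where "open_circle U \<longleftrightarrow> open (circle_of -` U)"

instance
  by standard (auto simp: open_circle_def vimage_Union intro: open_Int)

end

type_synonym torus3 = "circle ^ 3"

definition torus_of :: "real ^ 3 \<Rightarrow> torus3"
  where "torus_of x = (\<chi> i. circle_of (x $ i))"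

lift_definition circle_cos :: "circle \<Rightarrow> real" is cos
proof -
  fix x y :: real assume "\<exists>k::int. x - y = 2 * pi * of_int k"
  then have "\<exists>k::int. x = y + 2 * pi * of_int k" by (simp add: algebra_simps)
  then show "cos x = cos y" using sin_cos_eq_iff[of x y] by blast
qed

lift_definition circle_sin :: "circle \<Rightarrow> real" is sin
proof -
  fix x y :: real assume "\<exists>k::int. x - y = 2 * pi * of_int k"
  then have "\<exists>k::int. x = y + 2 * pi * of_int k" by (simp add: algebra_simps)
  then show "sin x = sin y" using sin_cos_eq_iff[of x y] by blast
qed


section \<open>Smooth maps and smooth embeddings\<close>

text \<open>\<open>C_diff n f\<close>: all iterated directional derivatives of \<open>f\<close> up to order \<open>n\<close> exist and are
  continuous.\<close>

primrec C_diff :: "nat \<Rightarrow> ('a::real_normed_vector \<Rightarrow> 'b::real_normed_vector) \<Rightarrow> bool" where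
  "C_diff 0 f \<longleftrightarrow> continuous_on UNIV f"
| "C_diff (Suc n) f \<longleftrightarrow>
     (\<forall>x. f differentiable (at x)) \<and> (\<forall>v. C_diff n (\<lambda>x. frechet_derivative f (at x) v))"

text \<open>The projection \<open>torus_of\<close> is a local diffeomorphism for the standard smooth structure of the
  torus, so smoothness and immersivity are conditions on the periodic lift to \<open>real ^ 3\<close>.\<close>

definition torus_smooth :: "(torus3 \<Rightarrow> 'b::real_normed_vector) \<Rightarrow> bool"
  where "torus_smooth f \<longleftrightarrow> (\<forall>n. C_diff n (f \<circ> torus_of))"

definition torus_immersion :: "(torus3 \<Rightarrow> 'b::real_normed_vector) \<Rightarrow> bool"
  where "torus_immersion f \<longleftrightarrow>
    torus_smooth f \<and> (\<forall>x. inj (frechet_derivative (f \<circ> torus_of) (at x)))"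

text \<open>Smooth embedding of the torus into a linear subspace \<open>V\<close> of a normed space.\<close>

definition torus_smooth_embedding :: "'b::real_normed_vector set \<Rightarrow> (torus3 \<Rightarrow> 'b) \<Rightarrow> bool"
  where "torus_smooth_embedding V f \<longleftrightarrow>
    range f \<subseteq> V \<and> torus_immersion f \<and> embedding_map euclidean (top_of_set V) f"

definition Sym_mats :: "(real ^ 'm ^ 'm) set"
  where "Sym_mats = {A. transpose A = A}"

definition Gamma_map :: "(torus3 \<Rightarrow> real ^ 'm) \<Rightarrow> torus3 \<Rightarrow> real ^ 'm ^ 'm"
  where "Gamma_map b x = (\<chi> i j. b x $ i * b x $ j)"


section \<open>The Sobolev space H1 of the torus\<close>

definition torus_measure :: "torus3 measure"
  where "torus_measure =
    distr (restrict_space lborel {x. \<forall>i. 0 \<le> x $ i \<and> x $ i < 2 * pi}) borel torus_of"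

text \<open>By periodicity the value does not depend on the chosen representative of \<open>p\<close>.\<close>

definition torus_partial :: "3 \<Rightarrow> (torus3 \<Rightarrow> real) \<Rightarrow> torus3 \<Rightarrow> real"
  where "torus_partial i \<phi> p =
    frechet_derivative (\<phi> \<circ> torus_of) (at (SOME x. torus_of x = p)) (axis i 1)"

definition torus_L2 :: "(torus3 \<Rightarrow> real) \<Rightarrow> bool"
  where "torus_L2 u \<longleftrightarrow>
    u \<in> borel_measurable torus_measure \<and> integrable torus_measure (\<lambda>x. (u x)\<^sup>2)"

definition is_weak_partial :: "3 \<Rightarrow> (torus3 \<Rightarrow> real) \<Rightarrow> (torus3 \<Rightarrow> real) \<Rightarrow> bool"
  where "is_weak_partial i u g \<longleftrightarrow>
    (\<forall>\<phi>. torus_smooth \<phi> \<longrightarrow>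
      (LINT x|torus_measure. u x * torus_partial i \<phi> x) = - (LINT x|torus_measure. g x * \<phi> x))"

text \<open>Elements of \<open>torus_H1\<close> are functions rather than classes modulo null sets. The weak partial
  derivative is unique only almost everywhere, which does not affect the seminorm \<open>H1_norm\<close>.\<close>

definition torus_H1 :: "(torus3 \<Rightarrow> real) set"
  where "torus_H1 = {u. torus_L2 u \<and> (\<forall>i. \<exists>g. torus_L2 g \<and> is_weak_partial i u g)}"

definition weak_partial :: "3 \<Rightarrow> (torus3 \<Rightarrow> real) \<Rightarrow> torus3 \<Rightarrow> real"
  where "weak_partial i u = (SOME g. torus_L2 g \<and> is_weak_partial i u g)"

definition H1_norm :: "(torus3 \<Rightarrow> real) \<Rightarrow> real"
  where "H1_norm u =
    sqrt ((LINT x|torus_measure. (u x)\<^sup>2) +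
          (\<Sum>i\<in>UNIV. LINT x|torus_measure. (weak_partial i u x)\<^sup>2))"

definition dense_in_H1 :: "(torus3 \<Rightarrow> real) set \<Rightarrow> bool"
  where "dense_in_H1 S \<longleftrightarrow>
    S \<subseteq> torus_H1 \<and> (\<forall>u\<in>torus_H1. \<forall>\<epsilon>>0. \<exists>s\<in>S. H1_norm (\<lambda>x. u x - s x) < \<epsilon>)"


section \<open>Cubic saturation\<close>

primrec cubic_set :: "(torus3 \<Rightarrow> real ^ 'm) \<Rightarrow> nat \<Rightarrow> (torus3 \<Rightarrow> real) set" where
  "cubic_set b 0 = {\<lambda>x. b x $ j | j. True}"
| "cubic_set b (Suc n) =
     cubic_set b n \<union> {\<lambda>x. \<phi> x * b x $ j * b x $ k | \<phi> j k. \<phi> \<in> cubic_set b n}"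

text \<open>Real linear span in the space of functions with pointwise operations.\<close>

definition cubic_span :: "(torus3 \<Rightarrow> real ^ 'm) \<Rightarrow> (torus3 \<Rightarrow> real) set"
  where "cubic_span b = module.span (\<lambda>c f x. c * f x) (\<Union>n. cubic_set b n)"

definition cubically_saturating :: "(torus3 \<Rightarrow> real ^ 'm) \<Rightarrow> bool"
  where "cubically_saturating b \<longleftrightarrow> dense_in_H1 (cubic_span b)"

definition explicit_profiles :: "real \<Rightarrow> real \<Rightarrow> real \<Rightarrow> torus3 \<Rightarrow> real ^ 4"
  where "explicit_profiles r R L x = vector
    [L + (R + r * circle_cos (x $ 3)) * circle_cos (x $ 1),
     (R + r * circle_cos (x $ 3)) * circle_sin (x $ 1),
     (R + r * circle_sin (x $ 3)) * circle_cos (x $ 2),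
     (R + r * circle_sin (x $ 3)) * circle_sin (x $ 2)]"

end

theory Submission
  imports Defs
begin

text \<open>Necessity of four profiles. The derivative of \<open>b b\<^sup>T\<close> in direction \<open>v\<close> is
\<open>(Db v) b\<^sup>T + b (Db v)\<^sup>T\<close>, so an immersion \<open>\<Gamma>\<^sub>b\<close> forces every \<open>Db\<close> to be injective.
With at most three profiles \<open>Db\<close> would then be surjective everywhere, but at a maximum point of a
single profile (the torus is compact) the corresponding row of \<open>Db\<close> vanishes
(\<open>four_profiles_necessary\<close>).

The explicit profiles. They are two copies of polar coordinates whose radii \<open>R + r cos x\<^sub>3\<close> and
\<open>R + r sin x\<^sub>3\<close> are positive, so \<open>b\<close> is an injective immersion. The shift \<open>L\<close> makes \<open>b\<^sub>1\<close>
positive, so \<open>b\<close> vanishes nowhere and never takes both of the values \<open>y\<close> and \<open>-y\<close>; hence \<open>b b\<^sup>T\<close>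
determines \<open>b\<close>, also infinitesimally. Compactness turns the injective immersion into an embedding
(\<open>explicit_embedding\<close>).

Saturation has an analytic half, in which the profiles do not occur, and an algebraic half.

Analytic half: trigonometric polynomials are dense in \<open>H\<^sup>1\<close>. They are dense in \<open>L\<^sup>2\<close> by
Stone--Weierstrass and a Dynkin-system argument. They are exhausted by finite-dimensional spaces
that are invariant under \<open>\<partial>\<^sub>i\<close>, and integration by parts shows that orthogonal projection onto such a
space commutes with \<open>\<partial>\<^sub>i\<close>, also for weak derivatives. So the projections of \<open>u\<close> converge to \<open>u\<close>
together with their derivatives (\<open>trig_polys_dense_H1\<close>). Consequently any set of smooth functions
whose \<open>C\<^sup>1\<close>-closure contains the trigonometric polynomials is dense in \<open>H\<^sup>1\<close> (\<open>dense_in_H1I\<close>).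

Algebraic half: the span of the cubic sets is closed under multiplication by even polynomials in
\<open>b\<close>. The \<open>C\<^sup>1\<close>-closure \<open>C\<close> of the even polynomials is an algebra that is stable under composition with
continuously differentiable functions of one variable (\<open>C1_closure_compose\<close>), by approximating the
derivative of such a function by a polynomial. Since \<open>b\<^sub>1\<close> is positive, \<open>C\<close> contains
\<open>b\<^sub>1 = sqrt (b\<^sub>1\<^sup>2)\<close>, then \<open>1 / b\<^sub>1\<close>, then \<open>b\<^sub>j = (b\<^sub>1 b\<^sub>j) / b\<^sub>1\<close>: the parity restriction has
disappeared. Square roots and quotients recover the radii and with them all
\<open>cos x\<^sub>i\<close> and \<open>sin x\<^sub>i\<close>, so \<open>C\<close> contains the trigonometric polynomials. Finally, a function \<open>v\<close> in \<open>C\<close>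
is written as \<open>b\<^sub>1 (v / b\<^sub>1)\<close>; approximating the second factor by even polynomials approximates \<open>v\<close> by
elements of the cubic span (\<open>cubic_span_C1_dense\<close>).\<close>

section \<open>The torus as a quotient of real space\<close>

lemma circle_of_eq_iff: "circle_of x = circle_of y \<longleftrightarrow> (\<exists>k::int. x - y = 2 * pi * of_int k)"
  by (rule circle.abs_eq_iff)

lemma circle_of_surj_period: "\<exists>x. 0 \<le> x \<and> x < 2 * pi \<and> circle_of x = c"
proof -
  obtain y where y: "c = circle_of y"
    by (induction c rule: circle.abs_induct) blast
  define x where "x = y - 2 * pi * of_int \<lfloor>y / (2 * pi)\<rfloor>"
  have "of_int \<lfloor>y / (2 * pi)\<rfloor> * (2 * pi) \<le> y" "y < (of_int \<lfloor>y / (2 * pi)\<rfloor> + 1) * (2 * pi)"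
    by (rule floor_divide_lower floor_divide_upper; simp)+
  then have "0 \<le> x" "x < 2 * pi"
    by (auto simp: x_def algebra_simps)
  moreover have "circle_of x = c"
    unfolding y circle_of_eq_iff by (rule exI[of _ "- \<lfloor>y / (2 * pi)\<rfloor>"]) (simp add: x_def)
  ultimately show ?thesis by blast
qed

definition period_cube :: "(real ^ 3) set"
  where "period_cube = {x. \<forall>i. 0 \<le> x $ i \<and> x $ i < 2 * pi}"

lemma torus_of_nth [simp]: "torus_of x $ i = circle_of (x $ i)"
  by (simp add: torus_of_def)

lemma torus_of_surj_cube: "\<exists>x\<in>period_cube. torus_of x = p"
proof -
  have "\<forall>i. \<exists>x. 0 \<le> x \<and> x < 2 * pi \<and> circle_of x = p $ i"
    using circle_of_surj_period by blast
  then obtain X where "\<forall>i. 0 \<le> X i \<and> X i < 2 * pi \<and> circle_of (X i) = p $ i" by metis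
  then have "(\<chi> i. X i) \<in> period_cube" "torus_of (\<chi> i. X i) = p"
    by (auto simp: period_cube_def vec_eq_iff)
  then show ?thesis by blast
qed

lemma torus_cases: obtains x where "p = torus_of x"
  using torus_of_surj_cube by metis

lemma torus_of_add_eq: "torus_of x = torus_of y \<Longrightarrow> torus_of (x + z) = torus_of (y + z)"
  by (simp add: vec_eq_iff circle_of_eq_iff)

lemma torus_of_add_period [simp]: "torus_of (x + axis i (2 * pi)) = torus_of x"
  by (auto simp: vec_eq_iff circle_of_eq_iff axis_def intro: exI[of _ 1] exI[of _ 0])

lemma continuous_circle_of: "continuous_on UNIV circle_of"
  by (simp add: continuous_on_open_vimage open_circle_def)

lemma continuous_torus_of: "continuous_on A torus_of"
  unfolding torus_of_def
  by (intro continuous_on_vec_lambda continuous_on_compose2[OF continuous_circle_of]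
      continuous_on_component continuous_on_id) auto

lemma open_circle_image:
  assumes "open U" shows "open (circle_of ` U)"
proof -
  have "circle_of -` (circle_of ` U) = (\<Union>k::int. (\<lambda>x. x + 2 * pi * of_int k) ` U)"
  proof (intro set_eqI iffI)
    fix x assume "x \<in> circle_of -` (circle_of ` U)"
    then obtain u k where "u \<in> U" "x - u = 2 * pi * of_int k"
      by (auto simp: circle_of_eq_iff)
    then show "x \<in> (\<Union>k::int. (\<lambda>x. x + 2 * pi * of_int k) ` U)"
      by (intro UN_I[of k] image_eqI[of _ _ u]) auto
  next
    fix x assume "x \<in> (\<Union>k::int. (\<lambda>x. x + 2 * pi * of_int k) ` U)"
    then obtain u k where "u \<in> U" "x = u + 2 * pi * of_int k" by auto
    then show "x \<in> circle_of -` (circle_of ` U)"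
      by (auto simp: circle_of_eq_iff intro!: image_eqI[of _ _ u] exI[of _ k])
  qed
  moreover have "open ((\<lambda>x. x + c) ` U)" for c :: real
    using open_translation[OF assms, of c] by (simp add: add.commute)
  ultimately show ?thesis
    by (auto simp: open_circle_def)
qed

lemma open_torus_image:
  assumes "open U" shows "open (torus_of ` U)"
  unfolding open_vec_def
proof
  fix p assume "p \<in> torus_of ` U"
  then obtain x where x: "x \<in> U" "p = torus_of x" by blast
  obtain A where A: "\<And>i. open (A i)" "\<And>i. x $ i \<in> A i" "\<And>y. (\<forall>i. y $ i \<in> A i) \<Longrightarrow> y \<in> U"
    using assms x(1) unfolding open_vec_def by meson
  have "q \<in> torus_of ` U" if q: "\<forall>i. q $ i \<in> circle_of ` A i" for q
  proof -
    obtain Y where Y: "\<And>i. Y i \<in> A i" "\<And>i. q $ i = circle_of (Y i)"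
      using q unfolding image_iff by metis
    have "(\<chi> i. Y i) \<in> U" "torus_of (\<chi> i. Y i) = q"
      using Y A(3) by (auto simp: vec_eq_iff)
    then show ?thesis by blast
  qed
  moreover have "\<forall>i. open (circle_of ` A i) \<and> p $ i \<in> circle_of ` A i"
    using A x open_circle_image by auto
  ultimately show "\<exists>A. (\<forall>i. open (A i) \<and> p $ i \<in> A i) \<and>
      (\<forall>y. (\<forall>i. y $ i \<in> A i) \<longrightarrow> y \<in> torus_of ` U)"
    by (intro exI[of _ "\<lambda>i. circle_of ` A i"]) blast
qed

text \<open>Since the projection is open, it is a quotient map.\<close>

lemma continuous_torus_iff:
  "continuous_on UNIV f \<longleftrightarrow> continuous_on UNIV (f \<circ> torus_of)"
proof
  assume "continuous_on UNIV f"
  then show "continuous_on UNIV (f \<circ> torus_of)"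
    using continuous_on_compose[OF continuous_torus_of, of UNIV f] continuous_on_subset by blast
next
  assume c: "continuous_on UNIV (f \<circ> torus_of)"
  have "f -` V = torus_of ` ((f \<circ> torus_of) -` V)" for V
  proof -
    have "p \<in> torus_of ` ((f \<circ> torus_of) -` V)" if "p \<in> f -` V" for p
      using that by (cases p rule: torus_cases) auto
    then show ?thesis by auto
  qed
  then show "continuous_on UNIV f"
    using c open_torus_image by (simp only: continuous_on_open_vimage[OF open_UNIV] Int_UNIV_right) metis
qed

lemma compact_torus: "compact (UNIV :: torus3 set)"
proof -
  have "UNIV = torus_of ` cbox 0 (vec (2 * pi))"
  proof -
    have "p \<in> torus_of ` cbox 0 (vec (2 * pi))" for p
    proof -
      obtain x where "x \<in> period_cube" "torus_of x = p" using torus_of_surj_cube by blast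
      then show ?thesis by (auto simp: image_iff mem_box_cart period_cube_def less_imp_le intro!: bexI[of _ x])
    qed
    then show ?thesis by auto
  qed
  then show ?thesis
    by (metis compact_cbox compact_continuous_image continuous_torus_of)
qed

lemma circle_cos_of [simp]: "circle_cos (circle_of x) = cos x"
  by (rule circle_cos.abs_eq)

lemma circle_sin_of [simp]: "circle_sin (circle_of x) = sin x"
  by (rule circle_sin.abs_eq)

lemma circle_cos_sin_sq: "(circle_cos c)\<^sup>2 + (circle_sin c)\<^sup>2 = 1"
  by (metis circle_cos_of circle_sin_of circle_of_surj_period sin_cos_squared_add2)

lemma circle_eqI:
  assumes "circle_cos c = circle_cos d" "circle_sin c = circle_sin d"
  shows "c = d"
proof -
  obtain x y where xy: "c = circle_of x" "d = circle_of y"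
    using circle_of_surj_period by metis
  then have "sin x = sin y" "cos x = cos y" using assms by auto
  then obtain k :: int where "x = y + 2 * pi * k" using sin_cos_eq_iff by blast
  then show ?thesis unfolding xy circle_of_eq_iff by auto
qed

section \<open>Differentiable functions on the torus\<close>

lemma frechet_derivative_worksI:
  "f differentiable F \<Longrightarrow> (f has_derivative frechet_derivative f F) F"
  by (simp add: frechet_derivative_works)

lemma frechet_derivative_at':
  "(f has_derivative f') (at x) \<Longrightarrow> frechet_derivative f (at x) = f'"
  by (rule frechet_derivative_at[symmetric])

text \<open>A lift is unchanged by translation along a period, so its derivative is the same at all lifts of
a point. This makes the arbitrary choice of representative in \<open>torus_partial\<close> harmless.\<close>

lemma has_derivative_torus_period:
  assumes "torus_of x = torus_of y" "((f \<circ> torus_of) has_derivative D) (at x)"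
  shows "((f \<circ> torus_of) has_derivative D) (at y)"
proof -
  have "((\<lambda>z. (f \<circ> torus_of) (z + (x - y))) has_derivative D) (at y)"
    by (rule has_derivative_compose[of "\<lambda>z. z + (x - y)" "\<lambda>z. z" y UNIV "f \<circ> torus_of" D])
      (auto intro!: derivative_eq_intros simp: assms)
  moreover have "(f \<circ> torus_of) (z + (x - y)) = (f \<circ> torus_of) z" for z
    using torus_of_add_eq[OF assms(1), of "z - y"] by (simp add: algebra_simps)
  ultimately show ?thesis by (simp only: )
qed

lemma torus_partial_eq:
  assumes "((f \<circ> torus_of) has_derivative D) (at x)"
  shows "torus_partial i f (torus_of x) = D (axis i 1)"
proof -
  define y where "y = (SOME y. torus_of y = torus_of x)"
  have "torus_of y = torus_of x" unfolding y_def by (rule someI) simp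
  then have "((f \<circ> torus_of) has_derivative D) (at y)"
    using has_derivative_torus_period[OF _ assms] by metis
  then show ?thesis
    unfolding torus_partial_def y_def using frechet_derivative_at by metis
qed

definition torus_differentiable :: "(torus3 \<Rightarrow> real) \<Rightarrow> bool"
  where "torus_differentiable f \<longleftrightarrow> (\<forall>x. (f \<circ> torus_of) differentiable (at x))"

lemma torus_differentiableD:
  "torus_differentiable f \<Longrightarrow>
    ((f \<circ> torus_of) has_derivative frechet_derivative (f \<circ> torus_of) (at x)) (at x)"
  by (simp add: torus_differentiable_def frechet_derivative_worksI)

lemma torus_partial_of:
  "torus_differentiable f \<Longrightarrow>
    torus_partial i f (torus_of x) = frechet_derivative (f \<circ> torus_of) (at x) (axis i 1)"
  by (intro torus_partial_eq torus_differentiableD)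

lemma torus_differentiable_const: "torus_differentiable (\<lambda>p. c)"
  by (simp add: torus_differentiable_def o_def)

lemma torus_partial_const: "torus_partial i (\<lambda>p. c) p = 0"
proof -
  obtain x where "p = torus_of x" by (rule torus_cases)
  then show ?thesis using torus_partial_eq[of "\<lambda>p. c" "\<lambda>_. 0" x i] by (simp add: o_def)
qed

lemma torus_differentiable_add:
  "torus_differentiable f \<Longrightarrow> torus_differentiable g \<Longrightarrow> torus_differentiable (\<lambda>p. f p + g p)"
  by (auto simp: torus_differentiable_def o_def)

lemma torus_partial_add:
  assumes "torus_differentiable f" "torus_differentiable g"
  shows "torus_partial i (\<lambda>p. f p + g p) p = torus_partial i f p + torus_partial i g p"
proof -
  obtain x where p: "p = torus_of x" by (rule torus_cases)
  show ?thesis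
    unfolding p torus_partial_of[OF assms(1)] torus_partial_of[OF assms(2)]
    by (rule torus_partial_eq)
      (use has_derivative_add[OF assms[THEN torus_differentiableD]] in \<open>simp add: o_def\<close>)
qed

lemma torus_differentiable_mult:
  "torus_differentiable f \<Longrightarrow> torus_differentiable g \<Longrightarrow> torus_differentiable (\<lambda>p. f p * g p)"
  by (auto simp: torus_differentiable_def o_def)

lemma torus_partial_mult:
  assumes "torus_differentiable f" "torus_differentiable g"
  shows "torus_partial i (\<lambda>p. f p * g p) p = torus_partial i f p * g p + f p * torus_partial i g p"
proof -
  obtain x where p: "p = torus_of x" by (rule torus_cases)
  have "((\<lambda>x. (f \<circ> torus_of) x * (g \<circ> torus_of) x) has_derivative
    (\<lambda>h. (f \<circ> torus_of) x * frechet_derivative (g \<circ> torus_of) (at x) h +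
      frechet_derivative (f \<circ> torus_of) (at x) h * (g \<circ> torus_of) x)) (at x)"
    by (rule has_derivative_mult[OF assms[THEN torus_differentiableD]])
  then show ?thesis
    unfolding p torus_partial_of[OF assms(1)] torus_partial_of[OF assms(2)]
    using torus_partial_eq[of "\<lambda>p. f p * g p"] by (simp add: o_def)
qed

text \<open>The outer function only has to be differentiable on the range of \<open>f\<close>, which allows square roots
and reciprocals of positive functions.\<close>

lemma torus_chain:
  assumes "torus_differentiable f" "\<And>p. (h has_real_derivative h' (f p)) (at (f p))"
  shows "torus_differentiable (\<lambda>p. h (f p))"
    and "torus_partial i (\<lambda>p. h (f p)) p = h' (f p) * torus_partial i f p"
proof -
  have *: "(((\<lambda>p. h (f p)) \<circ> torus_of) has_derivative
      (\<lambda>v. h' (f (torus_of x)) * frechet_derivative (f \<circ> torus_of) (at x) v)) (at x)" for x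
    using has_derivative_compose[OF torus_differentiableD[OF assms(1), of x], of h "(*) (h' (f (torus_of x)))"]
      assms(2)[of "torus_of x"]
    by (simp add: o_def has_field_derivative_def)
  then show "torus_differentiable (\<lambda>p. h (f p))"
    unfolding torus_differentiable_def differentiable_def by blast
  obtain x where p: "p = torus_of x" by (rule torus_cases)
  show "torus_partial i (\<lambda>p. h (f p)) p = h' (f p) * torus_partial i f p"
    unfolding p torus_partial_of[OF assms(1)] by (rule torus_partial_eq[OF *])
qed

lemma torus_has_derivative_cos_sin:
  "(((\<lambda>p. circle_cos (p $ j)) \<circ> torus_of) has_derivative (\<lambda>v. - sin (x $ j) * v $ j)) (at x)"
  "(((\<lambda>p. circle_sin (p $ j)) \<circ> torus_of) has_derivative (\<lambda>v. cos (x $ j) * v $ j)) (at x)"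
  by (auto simp: o_def intro!: derivative_eq_intros bounded_linear_imp_has_derivative
      bounded_linear_vec_nth)

lemma torus_partial_cos_sin:
  "torus_partial i (\<lambda>p. circle_cos (p $ j)) p = (if i = j then - circle_sin (p $ j) else 0)"
  "torus_partial i (\<lambda>p. circle_sin (p $ j)) p = (if i = j then circle_cos (p $ j) else 0)"
proof -
  obtain x where p: "p = torus_of x" by (rule torus_cases)
  show "torus_partial i (\<lambda>p. circle_cos (p $ j)) p = (if i = j then - circle_sin (p $ j) else 0)"
    "torus_partial i (\<lambda>p. circle_sin (p $ j)) p = (if i = j then circle_cos (p $ j) else 0)"
    unfolding p torus_partial_eq[OF torus_has_derivative_cos_sin(1)]
      torus_partial_eq[OF torus_has_derivative_cos_sin(2)]
    by (auto simp: axis_def)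
qed

section \<open>Smooth functions\<close>

lemma C_diff_SucD: "C_diff (Suc n) f \<Longrightarrow> C_diff n f"
proof (induction n arbitrary: f)
  case 0
  then show ?case
    by (simp add: continuous_at_imp_continuous_on differentiable_imp_continuous_within)
next
  case (Suc n)
  then show ?case by (metis C_diff.simps(2))
qed

lemma C_diff_const: "C_diff n (\<lambda>x. c)"
  by (induction n arbitrary: c) simp_all

lemma C_diff_add:
  "C_diff n f \<Longrightarrow> C_diff n g \<Longrightarrow> C_diff n (\<lambda>x. f x + g x)"
proof (induction n arbitrary: f g)
  case 0
  then show ?case by (auto intro: continuous_intros)
next
  case (Suc n)
  have "frechet_derivative (\<lambda>x. f x + g x) (at x) =
      (\<lambda>v. frechet_derivative f (at x) v + frechet_derivative g (at x) v)" for x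
    using Suc.prems by (intro frechet_derivative_at' has_derivative_add frechet_derivative_worksI) auto
  then show ?case using Suc by (auto intro: differentiable_add)
qed

lemma C_diff_mult:
  fixes f g :: "'a::real_normed_vector \<Rightarrow> real"
  shows "C_diff n f \<Longrightarrow> C_diff n g \<Longrightarrow> C_diff n (\<lambda>x. f x * g x)"
proof (induction n arbitrary: f g)
  case 0
  then show ?case by (auto intro: continuous_intros)
next
  case (Suc n)
  have "frechet_derivative (\<lambda>x. f x * g x) (at x) =
      (\<lambda>v. f x * frechet_derivative g (at x) v + frechet_derivative f (at x) v * g x)" for x
    using Suc.prems by (intro frechet_derivative_at' has_derivative_mult frechet_derivative_worksI) auto
  then show ?case using Suc C_diff_SucD[OF Suc.prems(1)] C_diff_SucD[OF Suc.prems(2)]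
    by (auto intro!: C_diff_add)
qed

lemma C_diff_cos_sin_nth:
  "C_diff n (\<lambda>x::real^'n. cos (x $ i)) \<and> C_diff n (\<lambda>x::real^'n. sin (x $ i))"
proof (induction n)
  case 0
  show ?case by (auto intro!: continuous_intros)
next
  case (Suc n)
  have c: "((\<lambda>x::real^'n. cos (x $ i)) has_derivative (\<lambda>v. (-1) * (sin (x $ i) * v $ i))) (at x)"
   and s: "((\<lambda>x::real^'n. sin (x $ i)) has_derivative (\<lambda>v. cos (x $ i) * v $ i)) (at x)" for x
    by (auto intro!: derivative_eq_intros bounded_linear_imp_has_derivative bounded_linear_vec_nth)
  have "C_diff n (\<lambda>x::real^'n. (-1) * (sin (x $ i) * v $ i))" "C_diff n (\<lambda>x::real^'n. cos (x $ i) * v $ i)"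
    for v :: "real^'n"
    using Suc by (intro C_diff_mult C_diff_const; simp)+
  then show ?case
    by (simp only: C_diff.simps frechet_derivative_at'[OF c] frechet_derivative_at'[OF s]
        differentiableI[OF c] differentiableI[OF s] simp_thms)
qed

text \<open>Reduces smoothness of vector- and matrix-valued maps to that of real-valued functions, for which
there is a product rule.\<close>

lemma C_diff_componentwise:
  fixes f :: "'a::real_normed_vector \<Rightarrow> 'b::euclidean_space"
  assumes "\<And>b. b \<in> Basis \<Longrightarrow> C_diff n (\<lambda>x. f x \<bullet> b)"
  shows "C_diff n f"
  using assms
proof (induction n arbitrary: f)
  case 0
  then show ?case using continuous_on_componentwise[of UNIV f] by simp
next
  case (Suc n)
  have d: "f differentiable (at x)" for x
    using Suc.prems differentiable_componentwise_within[of f x UNIV] by simp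
  have "C_diff n (\<lambda>x. frechet_derivative f (at x) v \<bullet> b)" if b: "b \<in> Basis" for v b
  proof -
    have "frechet_derivative (\<lambda>x. f x \<bullet> b) (at x) v = frechet_derivative f (at x) v \<bullet> b" for x
      using has_derivative_inner_left[OF frechet_derivative_worksI[OF d], of b x]
      by (simp add: frechet_derivative_at')
    then show ?thesis using Suc.prems[OF b] by (metis (no_types, lifting) C_diff.simps(2) ext)
  qed
  then show ?case using d Suc.IH by simp
qed

lemma torus_smooth_const: "torus_smooth (\<lambda>p. c)"
  by (simp add: torus_smooth_def o_def C_diff_const)

lemma torus_smooth_add: "torus_smooth f \<Longrightarrow> torus_smooth g \<Longrightarrow> torus_smooth (\<lambda>p. f p + g p)"
  by (simp add: torus_smooth_def o_def C_diff_add)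

lemma torus_smooth_mult:
  fixes f g :: "torus3 \<Rightarrow> real"
  shows "torus_smooth f \<Longrightarrow> torus_smooth g \<Longrightarrow> torus_smooth (\<lambda>p. f p * g p)"
  by (simp add: torus_smooth_def o_def C_diff_mult)

lemma torus_smooth_cos_sin:
  "torus_smooth (\<lambda>p. circle_cos (p $ j))" "torus_smooth (\<lambda>p. circle_sin (p $ j))"
  by (simp_all add: torus_smooth_def o_def C_diff_cos_sin_nth)

lemma torus_smooth_vec:
  fixes f :: "torus3 \<Rightarrow> 'b::euclidean_space ^ 'm"
  assumes "\<And>j b. b \<in> Basis \<Longrightarrow> torus_smooth (\<lambda>p. f p $ j \<bullet> b)"
  shows "torus_smooth f"
  unfolding torus_smooth_def
proof
  fix n
  show "C_diff n (f \<circ> torus_of)"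
  proof (rule C_diff_componentwise)
    fix c :: "'b ^ 'm" assume "c \<in> Basis"
    then obtain j b where c: "c = axis j b" "b \<in> Basis" unfolding Basis_vec_def by blast
    then have "C_diff n ((\<lambda>p. f p $ j \<bullet> b) \<circ> torus_of)"
      using assms torus_smooth_def by blast
    then show "C_diff n (\<lambda>x. (f \<circ> torus_of) x \<bullet> c)"
      by (simp add: c inner_axis o_def)
  qed
qed

lemma torus_smooth_imp_differentiable: "torus_smooth f \<Longrightarrow> torus_differentiable f"
  unfolding torus_smooth_def torus_differentiable_def using C_diff.simps(2) by blast

lemma torus_smooth_imp_continuous:
  "torus_smooth f \<Longrightarrow> continuous_on UNIV f"
  unfolding torus_smooth_def continuous_torus_iff using C_diff.simps(1) by blast

lemma torus_smooth_partial:
  assumes "torus_smooth f" shows "torus_smooth (torus_partial i f)"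
proof -
  have "torus_partial i f \<circ> torus_of = (\<lambda>x. frechet_derivative (f \<circ> torus_of) (at x) (axis i 1))"
    by (auto simp: torus_partial_of[OF torus_smooth_imp_differentiable[OF assms]])
  then show ?thesis
    using assms unfolding torus_smooth_def using C_diff.simps(2) by metis
qed

lemma torus_continuous_bounded:
  fixes f :: "torus3 \<Rightarrow> real"
  assumes "continuous_on UNIV f" obtains K where "\<And>p. \<bar>f p\<bar> \<le> K"
proof -
  have "bounded (range f)"
    using compact_continuous_image[OF assms compact_torus] compact_imp_bounded by blast
  then show ?thesis using that unfolding bounded_iff by auto
qed

section \<open>The quadratic map of the profiles\<close>

lemma has_derivative_vec:
  fixes f :: "'a::real_normed_vector \<Rightarrow> 'b::euclidean_space ^ 'm"
  assumes "\<And>i. ((\<lambda>x. f x $ i) has_derivative (\<lambda>v. D v $ i)) (at x)"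
  shows "(f has_derivative D) (at x)"
  unfolding has_derivative_componentwise_within[of f D x UNIV]
proof
  fix c :: "'b ^ 'm" assume "c \<in> Basis"
  then obtain j b where c: "c = axis j b" unfolding Basis_vec_def by blast
  show "((\<lambda>x. f x \<bullet> c) has_derivative (\<lambda>x. D x \<bullet> c)) (at x)"
    using has_derivative_inner_left[OF assms, of j b] by (simp add: c inner_axis)
qed

lemma Gamma_map_has_derivative:
  fixes b :: "torus3 \<Rightarrow> real ^ 'm"
  assumes "((b \<circ> torus_of) has_derivative D) (at x)"
  shows "((Gamma_map b \<circ> torus_of) has_derivative
    (\<lambda>v. \<chi> i j. b (torus_of x) $ i * D v $ j + D v $ i * b (torus_of x) $ j)) (at x)"
proof (rule has_derivative_vec, rule has_derivative_vec)
  fix i j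
  have "((\<lambda>x. b (torus_of x) $ k) has_derivative (\<lambda>v. D v $ k)) (at x)" for k
    using bounded_linear.has_derivative[OF bounded_linear_vec_nth assms] by (simp add: o_def)
  from has_derivative_mult[OF this this]
  show "((\<lambda>x. (Gamma_map b \<circ> torus_of) x $ i $ j) has_derivative
      (\<lambda>v. (\<chi> i j. b (torus_of x) $ i * D v $ j + D v $ i * b (torus_of x) $ j) $ i $ j)) (at x)"
    by (simp add: Gamma_map_def)
qed

lemma Gamma_map_sym: "Gamma_map b p \<in> Sym_mats"
  by (simp add: Sym_mats_def Gamma_map_def transpose_def mult.commute)

lemma torus_smooth_Gamma_map:
  fixes b :: "torus3 \<Rightarrow> real ^ 'm"
  assumes "\<And>j. torus_smooth (\<lambda>p. b p $ j)"
  shows "torus_smooth (Gamma_map b)"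
proof (rule torus_smooth_vec)
  fix i and c :: "real ^ 'm" assume "c \<in> Basis"
  then obtain j where c: "c = axis j 1" by (auto simp: Basis_vec_def)
  show "torus_smooth (\<lambda>p. Gamma_map b p $ i \<bullet> c)"
    using torus_smooth_mult[OF assms assms, of i j] by (simp add: c inner_axis Gamma_map_def)
qed

lemma immersion_Gamma_imp_inj_derivative:
  fixes b :: "torus3 \<Rightarrow> real ^ 'm"
  assumes "torus_immersion (Gamma_map b)" "((b \<circ> torus_of) has_derivative D) (at x)"
  shows "inj D"
proof -
  have G: "inj (\<lambda>v. \<chi> i j. b (torus_of x) $ i * D v $ j + D v $ i * b (torus_of x) $ j)"
    using assms(1) frechet_derivative_at'[OF Gamma_map_has_derivative[OF assms(2)]]
    unfolding torus_immersion_def by metis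
  show ?thesis
  proof (rule injI)
    fix v w assume "D v = D w"
    then show "v = w" by (intro injD[OF G]) simp
  qed
qed

text \<open>Suppose \<open>w b\<^sup>T + b w\<^sup>T = 0\<close> with \<open>w = Db v\<close>, and let \<open>b\<^sub>i \<noteq> 0\<close>. The diagonal entry \<open>2 b\<^sub>i w\<^sub>i\<close>
gives \<open>w\<^sub>i = 0\<close>, and then the entries \<open>b\<^sub>i w\<^sub>j\<close> of the same row give \<open>w = 0\<close>.\<close>

lemma Gamma_map_immersion:
  fixes b :: "torus3 \<Rightarrow> real ^ 'm"
  assumes "\<And>j. torus_smooth (\<lambda>p. b p $ j)" "\<And>p. b p \<noteq> 0"
    and D: "\<And>x. ((b \<circ> torus_of) has_derivative D x) (at x)" "\<And>x v. D x v = 0 \<Longrightarrow> v = 0"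
  shows "torus_immersion (Gamma_map b)"
  unfolding torus_immersion_def
proof (intro conjI allI)
  show "torus_smooth (Gamma_map b)" by (rule torus_smooth_Gamma_map[OF assms(1)])
  fix x
  let ?G = "\<lambda>v. \<chi> i j. b (torus_of x) $ i * D x v $ j + D x v $ i * b (torus_of x) $ j"
  note G = Gamma_map_has_derivative[OF D(1)[of x]]
  have "linear ?G" using G has_derivative_linear by blast
  moreover have "v = 0" if "?G v = 0" for v
  proof -
    obtain i where i: "b (torus_of x) $ i \<noteq> 0"
      using assms(2)[of "torus_of x"] by (metis vec_eq_iff zero_index)
    have e: "b (torus_of x) $ i * D x v $ j + D x v $ i * b (torus_of x) $ j = 0" for j
      using that by (simp add: vec_eq_iff)
    have "D x v $ i = 0" using e[of i] i by simp
    then have "D x v $ j = 0" for j using e[of j] i by simp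
    then show ?thesis using D(2)[of x v] by (simp add: vec_eq_iff)
  qed
  ultimately have "inj ?G" using linear_injective_0 by blast
  then show "inj (frechet_derivative (Gamma_map b \<circ> torus_of) (at x))"
    by (simp only: frechet_derivative_at'[OF G])
qed

text \<open>The matrix \<open>b b\<^sup>T\<close> determines \<open>b\<close> up to a common sign, which positivity of one profile fixes.\<close>

lemma Gamma_map_inj:
  fixes b :: "torus3 \<Rightarrow> real ^ 'm"
  assumes "\<And>p. b p $ k > 0" "Gamma_map b p = Gamma_map b q"
  shows "b p = b q"
proof -
  have e: "b p $ i * b p $ j = b q $ i * b q $ j" for i j
    using assms(2) by (simp add: Gamma_map_def vec_eq_iff)
  have "(b p $ k)\<^sup>2 = (b q $ k)\<^sup>2" using e[of k k] by (simp add: power2_eq_square)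
  then have k: "b p $ k = b q $ k"
    using assms(1)[of p] assms(1)[of q] by (metis less_imp_le power2_eq_imp_eq)
  have "b p $ j = b q $ j" for j using e[of k j] assms(1)[of q] by (simp add: k)
  then show ?thesis by (simp add: vec_eq_iff)
qed

lemma torus_smooth_embeddingI:
  fixes f :: "torus3 \<Rightarrow> 'b::real_normed_vector"
  assumes "range f \<subseteq> V" "torus_immersion f" "inj f"
  shows "torus_smooth_embedding V f"
proof -
  have "continuous_on UNIV f"
    using assms(2) torus_smooth_imp_continuous unfolding torus_immersion_def by blast
  then have "embedding_map euclidean (top_of_set V) f"
    using assms compact_torus
    by (intro continuous_imp_embedding_map Hausdorff_space_subtopology)
      (auto simp: continuous_map_in_subtopology compact_space_def)
  then show ?thesis using assms unfolding torus_smooth_embedding_def by blast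
qed

text \<open>With at most three profiles the derivative of \<open>b\<close> would be onto, so no profile could have a
critical point, whereas every profile attains its maximum on the compact torus.\<close>

lemma four_profiles_necessary:
  fixes b :: "torus3 \<Rightarrow> real ^ 'm"
  assumes "torus_smooth b" "torus_immersion (Gamma_map b)"
  shows "4 \<le> CARD('m)"
proof (rule ccontr)
  assume "\<not> 4 \<le> CARD('m)"
  then have card: "CARD('m) \<le> 3" by simp
  fix k :: 'm
  have "continuous_on UNIV (\<lambda>p. b p $ k)"
    using torus_smooth_imp_continuous[OF assms(1)] by (rule continuous_on_component)
  then obtain p where p: "\<And>q. b q $ k \<le> b p $ k"
    using continuous_attains_sup[OF compact_torus] by blast
  obtain x where x: "p = torus_of x" by (rule torus_cases)
  have "(b \<circ> torus_of) differentiable (at x)"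
    using assms(1) C_diff.simps(2)[of 0] unfolding torus_smooth_def by blast
  then obtain D where D: "((b \<circ> torus_of) has_derivative D) (at x)"
    unfolding differentiable_def by blast
  have "inj D" by (rule immersion_Gamma_imp_inj_derivative[OF assms(2) D])
  then have "dim (range D) = 3"
    using dim_image_eq[of D UNIV] has_derivative_linear[OF D] by simp
  moreover have "dim (range D) \<le> CARD('m)" using dim_subset_UNIV[of "range D"] by simp
  ultimately have "dim (range D) = DIM(real ^ 'm)" using card by simp
  then have "span (range D) = UNIV" using dim_eq_full by blast
  then have "range D = UNIV"
    using linear_subspace_image[OF has_derivative_linear[OF D] subspace_UNIV] by (metis span_eq_iff)
  then obtain v where v: "D v = axis k 1" by (metis UNIV_I imageE)
  have "((\<lambda>x. b (torus_of x) $ k) has_derivative (\<lambda>v. D v $ k)) (at x)"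
    using bounded_linear.has_derivative[OF bounded_linear_vec_nth D] by (simp add: o_def)
  then have "(\<lambda>v. D v $ k) = (\<lambda>v. 0)"
    using differential_zero_maxmin[of x UNIV "\<lambda>x. b (torus_of x) $ k" "\<lambda>v. D v $ k"] p x by simp
  then have "D v $ k = 0" by meson
  then show False using v by simp
qed

section \<open>The explicit profiles\<close>

lemma vector_4:
  "(vector [a, b, c, d] :: 'a::zero ^ 4) $ 1 = a" "(vector [a, b, c, d] :: 'a ^ 4) $ 2 = b"
  "(vector [a, b, c, d] :: 'a ^ 4) $ 3 = c" "(vector [a, b, c, d] :: 'a ^ 4) $ 4 = d"
  unfolding vector_def by simp_all

lemma explicit_profiles_nth [simp]:
  "explicit_profiles r R L p $ 1 = L + (R + r * circle_cos (p $ 3)) * circle_cos (p $ 1)"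
  "explicit_profiles r R L p $ 2 = (R + r * circle_cos (p $ 3)) * circle_sin (p $ 1)"
  "explicit_profiles r R L p $ 3 = (R + r * circle_sin (p $ 3)) * circle_cos (p $ 2)"
  "explicit_profiles r R L p $ 4 = (R + r * circle_sin (p $ 3)) * circle_sin (p $ 2)"
  by (simp_all add: explicit_profiles_def vector_4)

lemma torus_smooth_explicit_nth: "torus_smooth (\<lambda>p. explicit_profiles r R L p $ j)"
proof -
  have "\<forall>j. torus_smooth (\<lambda>p. explicit_profiles r R L p $ j)"
    unfolding forall_4 explicit_profiles_nth
    by (intro conjI torus_smooth_add torus_smooth_mult torus_smooth_const torus_smooth_cos_sin)
  then show ?thesis by blast
qed

lemma torus_smooth_explicit: "torus_smooth (explicit_profiles r R L)"
  by (rule torus_smooth_vec) (simp add: torus_smooth_explicit_nth)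

lemma circle_cos_sin_bound: "\<bar>circle_cos c\<bar> \<le> 1" "\<bar>circle_sin c\<bar> \<le> 1"
  using circle_cos_sin_sq[of c] zero_le_power2[of "circle_cos c"] zero_le_power2[of "circle_sin c"]
  unfolding abs_square_le_1[symmetric] by linarith+

lemma explicit_radius_bounds:
  assumes "0 < r"
  shows "R - r \<le> R + r * circle_cos c" "R + r * circle_cos c \<le> R + r"
    "R - r \<le> R + r * circle_sin c" "R + r * circle_sin c \<le> R + r"
proof -
  have "\<bar>r * circle_cos c\<bar> \<le> r" "\<bar>r * circle_sin c\<bar> \<le> r"
    using circle_cos_sin_bound[of c] assms by (simp_all add: abs_mult mult_left_le)
  then show "R - r \<le> R + r * circle_cos c" "R + r * circle_cos c \<le> R + r"
    "R - r \<le> R + r * circle_sin c" "R + r * circle_sin c \<le> R + r" by linarith+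
qed

lemma explicit_first_bounds:
  assumes "0 < r" "r < R"
  shows "L - (R + r) \<le> explicit_profiles r R L p $ 1" "explicit_profiles r R L p $ 1 \<le> L + (R + r)"
proof -
  have "\<bar>(R + r * circle_cos (p $ 3)) * circle_cos (p $ 1)\<bar> \<le> (R + r) * 1"
    unfolding abs_mult using explicit_radius_bounds[OF assms(1), of R "p $ 3"] assms
    by (intro mult_mono circle_cos_sin_bound) auto
  then show "L - (R + r) \<le> explicit_profiles r R L p $ 1" "explicit_profiles r R L p $ 1 \<le> L + (R + r)"
    by (simp_all add: abs_le_iff)
qed

lemma polar_eq:
  fixes A B :: real
  assumes "A > 0" "B > 0" "A * circle_cos c = B * circle_cos d" "A * circle_sin c = B * circle_sin d"
  shows "A = B" "c = d"
proof -
  have "(A * circle_cos c)\<^sup>2 + (A * circle_sin c)\<^sup>2 = A\<^sup>2" for A c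
    using circle_cos_sin_sq[of c] by (simp add: power_mult_distrib flip: distrib_left)
  then have "A\<^sup>2 = B\<^sup>2" using assms(3,4) by metis
  then show "A = B" using assms(1,2) by (metis less_imp_le power2_eq_imp_eq)
  then show "c = d" using assms by (intro circle_eqI) auto
qed

text \<open>Each pair of profiles is a point of the plane in polar form with positive radius. The two radii
give \<open>cos x\<^sub>3\<close> and \<open>sin x\<^sub>3\<close>, the two angles are \<open>x\<^sub>1\<close> and \<open>x\<^sub>2\<close>.\<close>

lemma explicit_inj:
  assumes "0 < r" "r < R" "explicit_profiles r R L p = explicit_profiles r R L q"
  shows "p = q"
proof -
  have pos: "R + r * circle_cos c > 0" "R + r * circle_sin c > 0" for c
    using explicit_radius_bounds[OF assms(1), of R c] assms(2) by linarith+
  have e: "explicit_profiles r R L p $ j = explicit_profiles r R L q $ j" for j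
    using assms(3) by simp
  note 1 = polar_eq[OF pos(1) pos(1), of "p $ 3" "p $ 1" "q $ 3" "q $ 1"]
  note 2 = polar_eq[OF pos(2) pos(2), of "p $ 3" "p $ 2" "q $ 3" "q $ 2"]
  have c: "R + r * circle_cos (p $ 3) = R + r * circle_cos (q $ 3)" "p $ 1 = q $ 1"
    using 1 e[of 1] e[of 2] by simp_all
  have s: "R + r * circle_sin (p $ 3) = R + r * circle_sin (q $ 3)" "p $ 2 = q $ 2"
    using 2 e[of 3] e[of 4] by simp_all
  have "p $ 3 = q $ 3" using c(1) s(1) assms(1) by (intro circle_eqI) auto
  then show ?thesis using c(2) s(2) by (simp add: vec_eq_iff forall_3)
qed

lemma explicit_has_derivative:
  "((explicit_profiles r R L \<circ> torus_of) has_derivative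
    (\<lambda>v. vector [
      - r * sin (x $ 3) * v $ 3 * cos (x $ 1) - (R + r * cos (x $ 3)) * sin (x $ 1) * v $ 1,
      - r * sin (x $ 3) * v $ 3 * sin (x $ 1) + (R + r * cos (x $ 3)) * cos (x $ 1) * v $ 1,
      r * cos (x $ 3) * v $ 3 * cos (x $ 2) - (R + r * sin (x $ 3)) * sin (x $ 2) * v $ 2,
      r * cos (x $ 3) * v $ 3 * sin (x $ 2) + (R + r * sin (x $ 3)) * cos (x $ 2) * v $ 2])) (at x)"
  (is "(_ has_derivative ?D) _")
proof (rule has_derivative_vec)
  note [derivative_intros] = bounded_linear_imp_has_derivative[OF bounded_linear_vec_nth]
  have "\<forall>i. ((\<lambda>y. (explicit_profiles r R L \<circ> torus_of) y $ i) has_derivative (\<lambda>v. ?D v $ i)) (at x)"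
    unfolding forall_4 vector_4
    by (auto simp: o_def algebra_simps intro!: derivative_eq_intros)
  then show "((\<lambda>y. (explicit_profiles r R L \<circ> torus_of) y $ i) has_derivative (\<lambda>v. ?D v $ i)) (at x)" for i
    by blast
qed

lemma rotation_eq_0:
  fixes a b c s :: real
  assumes "a * c - b * s = 0" "a * s + b * c = 0" "c\<^sup>2 + s\<^sup>2 = 1"
  shows "a = 0" "b = 0"
proof -
  have "a * (c\<^sup>2 + s\<^sup>2) = c * (a * c - b * s) + s * (a * s + b * c)"
    "b * (c\<^sup>2 + s\<^sup>2) = c * (a * s + b * c) - s * (a * c - b * s)"
    by (simp_all add: algebra_simps power2_eq_square)
  then show "a = 0" "b = 0" unfolding assms by simp_all
qed

text \<open>For the kernel of the derivative, rotating the two rows of each polar pair into the radial and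
angular directions separates them: the angular rows give \<open>v\<^sub>1 = v\<^sub>2 = 0\<close>, the radial ones
\<open>v\<^sub>3 sin x\<^sub>3 = v\<^sub>3 cos x\<^sub>3 = 0\<close>.\<close>

lemma explicit_embedding:
  assumes "0 < r" "r < R" "R + r < L"
  shows "torus_smooth_embedding Sym_mats (Gamma_map (explicit_profiles r R L))"
proof (rule torus_smooth_embeddingI)
  have pos: "explicit_profiles r R L p $ 1 > 0" for p
    using explicit_first_bounds(1)[OF assms(1,2), of L p] assms(3) by linarith
  show "range (Gamma_map (explicit_profiles r R L)) \<subseteq> Sym_mats" using Gamma_map_sym by blast
  show "inj (Gamma_map (explicit_profiles r R L))"
    using Gamma_map_inj[OF pos] explicit_inj[OF assms(1,2)] by (meson injI)
  show "torus_immersion (Gamma_map (explicit_profiles r R L))"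
  proof (rule Gamma_map_immersion[OF torus_smooth_explicit_nth _ explicit_has_derivative])
    show "explicit_profiles r R L p \<noteq> 0" for p using pos[of p] by (metis less_irrefl zero_index)
    fix x v :: "real ^ 3"
    have A: "R + r * cos (x $ 3) > 0" "R + r * sin (x $ 3) > 0"
      using explicit_radius_bounds[OF assms(1), of R "circle_of (x $ 3)"] assms by auto
    assume "vector [
      - r * sin (x $ 3) * v $ 3 * cos (x $ 1) - (R + r * cos (x $ 3)) * sin (x $ 1) * v $ 1,
      - r * sin (x $ 3) * v $ 3 * sin (x $ 1) + (R + r * cos (x $ 3)) * cos (x $ 1) * v $ 1,
      r * cos (x $ 3) * v $ 3 * cos (x $ 2) - (R + r * sin (x $ 3)) * sin (x $ 2) * v $ 2,
      r * cos (x $ 3) * v $ 3 * sin (x $ 2) + (R + r * sin (x $ 3)) * cos (x $ 2) * v $ 2] = (0 :: real ^ 4)"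
      (is "?V = 0")
    then have "?V $ j = 0" for j by simp
    from this[of 1] this[of 2] this[of 3] this[of 4]
    have e: "(- r * sin (x $ 3) * v $ 3) * cos (x $ 1) - ((R + r * cos (x $ 3)) * v $ 1) * sin (x $ 1) = 0"
      "(- r * sin (x $ 3) * v $ 3) * sin (x $ 1) + ((R + r * cos (x $ 3)) * v $ 1) * cos (x $ 1) = 0"
      "(r * cos (x $ 3) * v $ 3) * cos (x $ 2) - ((R + r * sin (x $ 3)) * v $ 2) * sin (x $ 2) = 0"
      "(r * cos (x $ 3) * v $ 3) * sin (x $ 2) + ((R + r * sin (x $ 3)) * v $ 2) * cos (x $ 2) = 0"
      unfolding vector_4 by (simp_all only: mult_ac)
    note 1 = rotation_eq_0[OF e(1,2) sin_cos_squared_add2] and 2 = rotation_eq_0[OF e(3,4) sin_cos_squared_add2]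
    have "v $ 1 = 0" "v $ 2 = 0" using 1(2) 2(2) A by auto
    moreover have "v $ 3 = 0"
    proof (rule ccontr)
      assume "v $ 3 \<noteq> 0"
      then have "sin (x $ 3) = 0" "cos (x $ 3) = 0" using 1(1) 2(1) assms(1) by auto
      then show False using sin_cos_squared_add[of "x $ 3"] by simp
    qed
    ultimately show "v = 0" by (simp add: vec_eq_iff forall_3)
  qed
qed

section \<open>Integration on the torus\<close>

lemma period_cube_borel [measurable]: "period_cube \<in> sets borel"
proof -
  have "period_cube = (\<Inter>i\<in>UNIV. {x. 0 \<le> x $ i} \<inter> {x. x $ i < 2 * pi})"
    by (auto simp: period_cube_def)
  moreover have "{x :: real ^ 3. 0 \<le> x $ i} \<inter> {x. x $ i < 2 * pi} \<in> sets borel" for i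
    by (intro sets.Int borel_closed borel_open closed_Collect_le open_Collect_less continuous_intros)
  ultimately show ?thesis by (metis (no_types, lifting) sets.finite_INT UNIV_not_empty finite)
qed

lemma emeasure_period_cube: "emeasure lborel period_cube < \<infinity>"
proof -
  have "period_cube \<subseteq> cbox 0 (vec (2 * pi))"
    by (auto simp: period_cube_def mem_box_cart less_imp_le)
  then show ?thesis
    using bounded_subset[OF bounded_cbox] by (intro emeasure_bounded_finite) blast
qed

lemma torus_of_borel [measurable]: "torus_of \<in> borel \<rightarrow>\<^sub>M borel"
  by (rule borel_measurable_continuous_onI[OF continuous_torus_of])

lemma sets_torus_measure [simp, measurable_cong]: "sets torus_measure = sets borel"
  by (simp add: torus_measure_def)

lemma space_torus_measure [simp]: "space torus_measure = UNIV"
  by (simp add: torus_measure_def)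

lemma torus_measure_alt: "torus_measure = distr (restrict_space lborel period_cube) borel torus_of"
  by (simp add: torus_measure_def period_cube_def)

lemma torus_of_measurable_cube: "torus_of \<in> restrict_space lborel period_cube \<rightarrow>\<^sub>M borel"
  by (intro measurable_restrict_space1) simp

lemma torus_integral_eq:
  fixes f :: "torus3 \<Rightarrow> real"
  assumes "f \<in> borel_measurable borel"
  shows "(LINT p|torus_measure. f p) = (LINT x|lborel. indicator period_cube x * f (torus_of x))"
  unfolding torus_measure_alt integral_distr[OF torus_of_measurable_cube assms]
  by (subst integral_restrict_space) simp_all

interpretation torus_measure: finite_measure torus_measure
proof
  show "emeasure torus_measure (space torus_measure) \<noteq> \<infinity>"
    unfolding torus_measure_alt
    using emeasure_period_cube torus_of_measurable_cube
    by (simp add: emeasure_distr emeasure_restrict_space space_restrict_space)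
qed

lemma torus_integrable_bounded:
  fixes f :: "torus3 \<Rightarrow> real"
  assumes "f \<in> borel_measurable borel" "\<And>p. \<bar>f p\<bar> \<le> K"
  shows "integrable torus_measure f"
  using assms by (intro torus_measure.integrable_const_bound[of _ K]) (auto simp: measurable_cong_sets[OF sets_torus_measure refl])

lemma torus_integrable_continuous:
  fixes f :: "torus3 \<Rightarrow> real"
  assumes "continuous_on UNIV f" shows "integrable torus_measure f"
  using torus_continuous_bounded[OF assms] torus_integrable_bounded
    borel_measurable_continuous_onI[OF assms] by metis

section \<open>Integration by parts\<close>

lemma lborel_integral_translate:
  fixes f :: "'a::euclidean_space \<Rightarrow> real"
  assumes "f \<in> borel_measurable borel"
  shows "(LINT x|lborel. f (x + c)) = (LINT x|lborel. f x)"
proof -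
  have "(LINT x|distr lborel borel ((+) c). f x) = (LINT x|lborel. f (c + x))"
    by (rule integral_distr) (use assms in simp_all)
  then show ?thesis by (simp add: lborel_distr_plus add.commute)
qed

lemma integrable_dominated_by_cube:
  fixes h :: "real ^ 3 \<Rightarrow> real"
  assumes "h \<in> borel_measurable borel" "\<And>x. \<bar>h x\<bar> \<le> K * indicator period_cube x"
  shows "integrable lborel h"
proof (rule Bochner_Integration.integrable_bound[of _ "\<lambda>x. K * indicator period_cube x"])
  show "integrable lborel (\<lambda>x. K * indicator period_cube x :: real)"
    using emeasure_period_cube by simp
  show "AE x in lborel. norm (h x) \<le> norm (K * indicator period_cube x :: real)"
    using assms(2) by (intro AE_I2) (metis abs_ge_self order_trans real_norm_def)
qed (use assms in simp)

lemma mem_period_cube_iff: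
  "x \<in> period_cube \<longleftrightarrow> (\<forall>j. j \<noteq> i \<longrightarrow> 0 \<le> x $ j \<and> x $ j < 2 * pi) \<and> 0 \<le> x $ i \<and> x $ i < 2 * pi"
  unfolding period_cube_def by auto

text \<open>Translating the period cube by \<open>t\<close> in direction \<open>i\<close> pushes out the slab where
\<open>x\<^sub>i \<ge> 2\<pi> - t\<close>. Moving this slab back by one period, which a periodic integrand does not notice,
fills exactly the gap that was left at the other side.\<close>

lemma torus_integral_translate:
  fixes f :: "torus3 \<Rightarrow> real"
  assumes f: "continuous_on UNIV f" and t: "0 \<le> t" "t < 2 * pi"
  shows "(LINT x|lborel. indicator period_cube x * f (torus_of (x + axis i t))) =
    (LINT p|torus_measure. f p)"
proof -
  obtain K where K: "\<And>p. \<bar>f p\<bar> \<le> K" using torus_continuous_bounded[OF f] by metis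
  have K0: "0 \<le> K" using K[of undefined] by linarith
  have [measurable]: "f \<in> borel_measurable borel" by (rule borel_measurable_continuous_onI[OF f])
  define A where "A = period_cube \<inter> {x. x $ i < 2 * pi - t}"
  define B where "B = period_cube - {x. x $ i < 2 * pi - t}"
  have "open {x :: real ^ 3. x $ i < 2 * pi - t}"
    by (intro open_Collect_less continuous_intros)
  then have [measurable]: "A \<in> sets borel" "B \<in> sets borel"
    unfolding A_def B_def by auto
  define c where "c = (axis i (2 * pi) :: real ^ 3)"
  define e where "e = (axis i t :: real ^ 3)"
  have ce: "torus_of (y - c + e) = torus_of (y + e)" for y
    using torus_of_add_period[of "y - c + e" i] by (simp add: c_def algebra_simps)
  have bnd: "\<bar>indicator S x * f p\<bar> \<le> K * indicator period_cube z"
    if "x \<in> S \<Longrightarrow> z \<in> period_cube" for x p and S :: "(real ^ 3) set" and z :: "real ^ 3"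
    using that K[of p] K0 by (auto simp: indicator_def)
  have split: "indicator A (y - e) + indicator B (y - e + c) = (indicator period_cube y :: real)" for y
  proof -
    have "(y - e) $ j = y $ j" "(y - e + c) $ j = y $ j" if "j \<noteq> i" for j
      using that by (auto simp: e_def c_def axis_def)
    moreover have "(y - e) $ i = y $ i - t" "(y - e + c) $ i = y $ i - t + 2 * pi"
      by (auto simp: e_def c_def axis_def)
    ultimately have "y - e \<in> A \<longleftrightarrow> y \<in> period_cube \<and> t \<le> y $ i"
      "y - e + c \<in> B \<longleftrightarrow> y \<in> period_cube \<and> y $ i < t"
      unfolding A_def B_def Int_iff Diff_iff mem_period_cube_iff[of _ i] mem_Collect_eq using t by auto
    then show ?thesis by (auto simp: indicator_def)
  qed
  have sA: "y - e \<in> A \<Longrightarrow> y \<in> period_cube" and sB: "y - e + c \<in> B \<Longrightarrow> y \<in> period_cube" for y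
    using split[of y] by (auto simp: indicator_def of_bool_def split: if_splits)
  have iA: "integrable lborel (\<lambda>x. indicator A x * f (torus_of (x + e)))"
    and iB: "integrable lborel (\<lambda>x. indicator B x * f (torus_of (x + e)))"
    by (rule integrable_dominated_by_cube[where K=K], measurable, rule bnd, auto simp: A_def B_def)+
  have jA: "integrable lborel (\<lambda>y. indicator A (y - e) * f (torus_of y))"
    and jB: "integrable lborel (\<lambda>y. indicator B (y - e + c) * f (torus_of y))"
    by (rule integrable_dominated_by_cube[where K=K], measurable, rule bnd, auto intro: sA sB)+
  have "(LINT x|lborel. indicator A x * f (torus_of (x + e))) = (LINT y|lborel. indicator A (y - e) * f (torus_of y))"
    using lborel_integral_translate[of "\<lambda>y. indicator A (y - e) * f (torus_of y)" e] by simp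
  moreover have "(LINT x|lborel. indicator B x * f (torus_of (x + e))) = (LINT y|lborel. indicator B (y - e + c) * f (torus_of y))"
  proof -
    have "(LINT x|lborel. indicator B x * f (torus_of (x + e))) =
      (LINT x|lborel. indicator B (x + (e - c) - e + c) * f (torus_of (x + (e - c))))"
      using ce by (simp add: algebra_simps)
    also have "\<dots> = (LINT y|lborel. indicator B (y - e + c) * f (torus_of y))"
      by (rule lborel_integral_translate) measurable
    finally show ?thesis .
  qed
  moreover have "indicator period_cube x = (indicator A x + indicator B x :: real)" for x
    by (auto simp: A_def B_def indicator_def)
  ultimately have "(LINT x|lborel. indicator period_cube x * f (torus_of (x + e))) =
      (LINT y|lborel. indicator A (y - e) * f (torus_of y) + indicator B (y - e + c) * f (torus_of y))"
    using iA iB jA jB by (simp add: distrib_right)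
  also have "\<dots> = (LINT y|lborel. indicator period_cube y * f (torus_of y))"
    by (simp only: distrib_right[symmetric] split)
  finally show ?thesis by (simp add: torus_integral_eq e_def)
qed

lemma torus_line_derivative:
  assumes "torus_differentiable f"
  shows "((\<lambda>s. f (torus_of (x + axis i s))) has_real_derivative
    torus_partial i f (torus_of (x + axis i s))) (at s)"
proof -
  let ?D = "frechet_derivative (f \<circ> torus_of) (at (x + axis i s))"
  have ax: "axis i s = s *\<^sub>R (axis i 1 :: real ^ 3)" for s :: real
    by (simp add: axis_def vec_eq_iff)
  have "((\<lambda>s. x + s *\<^sub>R axis i 1) has_derivative (\<lambda>h. h *\<^sub>R axis i 1)) (at s)"
    by (auto intro!: derivative_eq_intros)
  from has_derivative_compose[OF this, of "f \<circ> torus_of" ?D]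
  have "((\<lambda>s. f (torus_of (x + axis i s))) has_derivative (\<lambda>h. ?D (axis i h))) (at s)"
    using torus_differentiableD[OF assms, of "x + axis i s"] by (simp add: o_def flip: ax)
  moreover have "?D (axis i h) = torus_partial i f (torus_of (x + axis i s)) * h" for h
    unfolding ax[of h] torus_partial_of[OF assms]
    using torus_differentiableD[OF assms, of "x + axis i s", THEN has_derivative_linear]
    by (simp add: linear_cmul)
  ultimately show ?thesis
    by (simp add: has_field_derivative_def)
qed

lemma torus_differentiable_continuous:
  assumes "torus_differentiable f" shows "continuous_on UNIV f"
proof -
  have "continuous_on UNIV (f \<circ> torus_of)"
    using assms unfolding torus_differentiable_def
    by (intro continuous_at_imp_continuous_on ballI differentiable_imp_continuous_within) blast
  then show ?thesis using continuous_torus_iff by blast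
qed

text \<open>By translation invariance all difference quotients in direction \<open>i\<close> have integral zero. They are
bounded by the supremum of the derivative and converge to it, so dominated convergence applies.\<close>

lemma torus_integral_partial_eq_0:
  assumes f: "torus_differentiable f" and c: "continuous_on UNIV (torus_partial i f)"
  shows "(LINT p|torus_measure. torus_partial i f p) = 0"
proof -
  note fc = torus_differentiable_continuous[OF f]
  have axis_0: "axis i 0 = (0 :: real ^ 3)" by (simp add: axis_def vec_eq_iff)
  have [measurable]: "f \<in> borel_measurable borel" "torus_partial i f \<in> borel_measurable borel"
    by (rule borel_measurable_continuous_onI[OF fc], rule borel_measurable_continuous_onI[OF c])
  obtain K where K: "\<And>p. \<bar>torus_partial i f p\<bar> \<le> K" using torus_continuous_bounded[OF c] by metis
  obtain K' where K': "\<And>p. \<bar>f p\<bar> \<le> K'" using torus_continuous_bounded[OF fc] by metis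
  define h where "h n = 1 / real (Suc n)" for n
  have h: "0 < h n" "h n \<le> 1" "h n < 2 * pi" for n
  proof -
    show "0 < h n" "h n \<le> 1" by (auto simp: h_def field_simps)
    then show "h n < 2 * pi" using pi_ge_two by linarith
  qed
  have h0: "h \<longlonglongrightarrow> 0" unfolding h_def by (rule LIMSEQ_Suc[OF lim_1_over_n])
  define q where "q n x = indicator period_cube x * ((f (torus_of (x + axis i (h n))) - f (torus_of x)) / h n)" for n x
  have [measurable]: "q n \<in> borel_measurable borel" for n unfolding q_def by measurable
  have "(LINT x|lborel. q n x) = 0" for n
  proof -
    have int: "integrable lborel (\<lambda>x. indicator period_cube x * f (torus_of (x + e)))" for e
      using K' by (intro integrable_dominated_by_cube[where K=K']) (auto simp: indicator_def)
    have "(LINT x|lborel. q n x) = (LINT x|lborel. (indicator period_cube x * f (torus_of (x + axis i (h n)))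
        - indicator period_cube x * f (torus_of x)) / h n)"
      by (simp add: q_def algebra_simps diff_divide_distrib)
    also have "\<dots> = ((LINT x|lborel. indicator period_cube x * f (torus_of (x + axis i (h n))))
        - (LINT x|lborel. indicator period_cube x * f (torus_of x))) / h n"
      using int[of "axis i (h n)"] int[of 0] by simp
    also have "\<dots> = 0"
      using torus_integral_translate[OF fc less_imp_le[OF h(1)] h(3), of i n] by (simp add: torus_integral_eq)
    finally show ?thesis .
  qed
  moreover have "(\<lambda>n. LINT x|lborel. q n x) \<longlonglongrightarrow> (LINT x|lborel. indicator period_cube x * torus_partial i f (torus_of x))"
  proof (rule integral_dominated_convergence[where w="\<lambda>x. K * indicator period_cube x"])
    show "integrable lborel (\<lambda>x. K * indicator period_cube x :: real)"
      using emeasure_period_cube by simp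
    have "(\<lambda>n. q n x) \<longlonglongrightarrow> indicator period_cube x * torus_partial i f (torus_of x)" for x
    proof -
      have "((\<lambda>s. (f (torus_of (x + axis i s)) - f (torus_of x)) / s) \<longlongrightarrow> torus_partial i f (torus_of x)) (at 0)"
        using torus_line_derivative[OF f, of x i 0] axis_0 by (simp add: DERIV_def)
      moreover have "filterlim h (at 0) sequentially"
        unfolding filterlim_at using h0 h(1) by (auto simp: less_imp_neq[symmetric])
      ultimately have "(\<lambda>n. (f (torus_of (x + axis i (h n))) - f (torus_of x)) / h n) \<longlonglongrightarrow> torus_partial i f (torus_of x)"
        by (rule filterlim_compose)
      then show ?thesis unfolding q_def by (intro tendsto_mult tendsto_const)
    qed
    then show "AE x in lborel. (\<lambda>n. q n x) \<longlonglongrightarrow> indicator period_cube x * torus_partial i f (torus_of x)" by simp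
    have "norm (q n x) \<le> K * indicator period_cube x" for n x
    proof -
      obtain s where "f (torus_of (x + axis i (h n))) - f (torus_of (x + axis i 0)) =
          (h n - 0) * torus_partial i f (torus_of (x + axis i s))"
        using MVT2[OF h(1)[of n], of "\<lambda>s. f (torus_of (x + axis i s))"
            "\<lambda>s. torus_partial i f (torus_of (x + axis i s))"] torus_line_derivative[OF f] by blast
      then have "(f (torus_of (x + axis i (h n))) - f (torus_of x)) / h n = torus_partial i f (torus_of (x + axis i s))"
        using h(1)[of n] axis_0 by simp
      then show ?thesis unfolding q_def using K by (auto simp: indicator_def)
    qed
    then show "AE x in lborel. norm (q n x) \<le> K * indicator period_cube x" for n by simp
  qed simp_all
  ultimately have "(LINT x|lborel. indicator period_cube x * torus_partial i f (torus_of x)) = 0"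
    using LIMSEQ_unique[OF _ tendsto_const] by force
  then show ?thesis by (simp add: torus_integral_eq)
qed

lemma torus_integrate_by_parts:
  assumes "torus_smooth f" "torus_smooth g"
  shows "(LINT p|torus_measure. f p * torus_partial i g p) = - (LINT p|torus_measure. torus_partial i f p * g p)"
proof -
  have d: "torus_differentiable f" "torus_differentiable g"
    using assms torus_smooth_imp_differentiable by blast+
  have e: "torus_partial i (\<lambda>p. f p * g p) = (\<lambda>p. torus_partial i f p * g p + f p * torus_partial i g p)"
    using torus_partial_mult[OF d] by blast
  have c: "continuous_on UNIV (\<lambda>p. torus_partial i f p * g p)" "continuous_on UNIV (\<lambda>p. f p * torus_partial i g p)"
    using assms by (auto intro!: torus_smooth_imp_continuous torus_smooth_mult torus_smooth_partial)
  have "(LINT p|torus_measure. torus_partial i f p * g p + f p * torus_partial i g p) = 0"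
    using torus_integral_partial_eq_0[OF torus_differentiable_mult[OF d], of i] c
    unfolding e by (simp add: continuous_on_add)
  then show ?thesis using c[THEN torus_integrable_continuous] by simp
qed

section \<open>Square integrable functions\<close>

lemma torus_L2_iff:
  "torus_L2 u \<longleftrightarrow> u \<in> borel_measurable borel \<and> integrable torus_measure (\<lambda>x. (u x)\<^sup>2)"
  by (simp add: torus_L2_def measurable_cong_sets[OF sets_torus_measure refl])

lemma torus_L2_measurable: "torus_L2 u \<Longrightarrow> u \<in> borel_measurable borel"
  by (simp add: torus_L2_iff)

lemma torus_L2_integrable_mult:
  assumes "torus_L2 u" "torus_L2 v"
  shows "integrable torus_measure (\<lambda>x. u x * v x)"
proof (rule Bochner_Integration.integrable_bound[of _ "\<lambda>x. (u x)\<^sup>2 + (v x)\<^sup>2"])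
  show "integrable torus_measure (\<lambda>x. (u x)\<^sup>2 + (v x)\<^sup>2)" using assms by (simp add: torus_L2_iff)
  have "u \<in> borel_measurable borel" "v \<in> borel_measurable borel" using assms torus_L2_measurable by auto
  then show "(\<lambda>x. u x * v x) \<in> borel_measurable torus_measure"
    unfolding measurable_cong_sets[OF sets_torus_measure refl] by (rule borel_measurable_times)
  have "\<bar>a * b\<bar> \<le> a\<^sup>2 + b\<^sup>2" for a b :: real
    using sum_squares_bound[of "\<bar>a\<bar>" "\<bar>b\<bar>"] abs_ge_zero[of "a * b"] unfolding power2_abs abs_mult by linarith
  then show "AE x in torus_measure. norm (u x * v x) \<le> norm ((u x)\<^sup>2 + (v x)\<^sup>2)"
    by (intro AE_I2) simp
qed

lemma torus_L2_add:
  assumes "torus_L2 u" "torus_L2 v" shows "torus_L2 (\<lambda>x. u x + v x)"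
proof -
  have "integrable torus_measure (\<lambda>x. (u x)\<^sup>2 + (v x)\<^sup>2 + 2 * (u x * v x))"
    using assms torus_L2_integrable_mult[OF assms] by (simp add: torus_L2_iff)
  then show ?thesis
    using assms by (simp add: torus_L2_iff borel_measurable_add power2_sum mult.assoc)
qed

lemma torus_L2_scale: "torus_L2 u \<Longrightarrow> torus_L2 (\<lambda>x. c * u x)"
  by (simp add: torus_L2_iff borel_measurable_times power_mult_distrib)

lemma torus_L2_diff: "torus_L2 u \<Longrightarrow> torus_L2 v \<Longrightarrow> torus_L2 (\<lambda>x. u x - v x)"
  using torus_L2_add[OF _ torus_L2_scale[of v "-1"], of u] by simp

lemma torus_L2_bounded:
  assumes "f \<in> borel_measurable borel" "\<And>p. \<bar>f p\<bar> \<le> K" shows "torus_L2 f"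
proof -
  have "\<bar>(f p)\<^sup>2\<bar> \<le> K\<^sup>2" for p
    using assms(2)[of p] by (metis abs_ge_zero abs_power2 power2_abs power_mono)
  then show ?thesis
    using assms torus_integrable_bounded[of "\<lambda>p. (f p)\<^sup>2" "K\<^sup>2"] by (simp add: torus_L2_iff borel_measurable_power)
qed

lemma torus_L2_continuous: "continuous_on UNIV f \<Longrightarrow> torus_L2 f"
  using torus_continuous_bounded torus_L2_bounded borel_measurable_continuous_onI by metis

lemma torus_L2_smooth: "torus_smooth f \<Longrightarrow> torus_L2 f"
  by (intro torus_L2_continuous torus_smooth_imp_continuous)

definition L2_inner :: "(torus3 \<Rightarrow> real) \<Rightarrow> (torus3 \<Rightarrow> real) \<Rightarrow> real"
  where "L2_inner u v = (LINT p|torus_measure. u p * v p)"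

lemma L2_inner_self: "(LINT p|torus_measure. (u p)\<^sup>2) = L2_inner u u"
  by (simp add: L2_inner_def power2_eq_square)

lemma L2_inner_commute: "L2_inner u v = L2_inner v u"
  by (simp add: L2_inner_def mult.commute)

lemma L2_inner_nonneg: "0 \<le> L2_inner u u"
  by (simp add: L2_inner_def)

lemma L2_inner_add:
  assumes "torus_L2 u" "torus_L2 v" "torus_L2 w"
  shows "L2_inner (\<lambda>p. u p + v p) w = L2_inner u w + L2_inner v w"
    "L2_inner w (\<lambda>p. u p + v p) = L2_inner w u + L2_inner w v"
  using torus_L2_integrable_mult[of u w] torus_L2_integrable_mult[of v w]
    torus_L2_integrable_mult[of w u] torus_L2_integrable_mult[of w v] assms
  by (simp_all add: L2_inner_def algebra_simps)

lemma L2_inner_diff: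
  assumes "torus_L2 u" "torus_L2 v" "torus_L2 w"
  shows "L2_inner (\<lambda>p. u p - v p) w = L2_inner u w - L2_inner v w"
    "L2_inner w (\<lambda>p. u p - v p) = L2_inner w u - L2_inner w v"
  using torus_L2_integrable_mult[of u w] torus_L2_integrable_mult[of v w]
    torus_L2_integrable_mult[of w u] torus_L2_integrable_mult[of w v] assms
  by (simp_all add: L2_inner_def algebra_simps)

lemma L2_inner_scale:
  "L2_inner (\<lambda>p. c * u p) v = c * L2_inner u v" "L2_inner u (\<lambda>p. c * v p) = c * L2_inner u v"
  by (simp_all add: L2_inner_def mult.assoc mult.left_commute)

lemma L2_inner_add_self_le:
  assumes "torus_L2 u" "torus_L2 v"
  shows "L2_inner (\<lambda>p. u p + v p) (\<lambda>p. u p + v p) \<le> 2 * L2_inner u u + 2 * L2_inner v v"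
proof -
  note uv = torus_L2_add[OF assms] torus_L2_diff[OF assms]
  have "0 \<le> L2_inner (\<lambda>p. u p - v p) (\<lambda>p. u p - v p)" by (rule L2_inner_nonneg)
  then show ?thesis
    using assms uv by (simp add: L2_inner_add L2_inner_diff L2_inner_commute[of v u])
qed

lemma L2_inner_triangle:
  assumes "torus_L2 u" "torus_L2 v" "torus_L2 w"
  shows "L2_inner (\<lambda>p. u p - w p) (\<lambda>p. u p - w p) \<le>
    2 * L2_inner (\<lambda>p. u p - v p) (\<lambda>p. u p - v p) + 2 * L2_inner (\<lambda>p. v p - w p) (\<lambda>p. v p - w p)"
  using L2_inner_add_self_le[OF torus_L2_diff[OF assms(1,2)] torus_L2_diff[OF assms(2,3)]] by simp

lemma L2_inner_bounded:
  assumes "f \<in> borel_measurable borel" "\<And>p. \<bar>f p\<bar> \<le> K"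
  shows "L2_inner f f \<le> K\<^sup>2 * measure torus_measure UNIV"
proof -
  have "(LINT p|torus_measure. (f p)\<^sup>2) \<le> (LINT p|torus_measure. K\<^sup>2)"
    using torus_L2_bounded[OF assms] assms(2)
    by (intro integral_mono) (auto simp: torus_L2_iff intro: power2_le_iff_abs_le[THEN iffD2] order_trans[OF abs_ge_zero])
  then show ?thesis by (simp add: L2_inner_self mult.commute)
qed

section \<open>Trigonometric polynomials\<close>

interpretation fun_space: module "\<lambda>(c::real) (f::torus3 \<Rightarrow> real) x. c * f x"
  by unfold_locales (auto simp: plus_fun_def algebra_simps)

lemma fun_span_add:
  "f \<in> fun_space.span S \<Longrightarrow> g \<in> fun_space.span S \<Longrightarrow> (\<lambda>x. f x + g x) \<in> fun_space.span S"
  using fun_space.span_add[of f S g] by (simp add: plus_fun_def)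

lemma fun_span_induct [consumes 1, case_names zero step]:
  assumes "f \<in> fun_space.span S" "P (\<lambda>x. 0)"
    "\<And>c \<phi> g. \<phi> \<in> S \<Longrightarrow> g \<in> fun_space.span S \<Longrightarrow> P g \<Longrightarrow> P (\<lambda>x. c * \<phi> x + g x)"
  shows "P f"
proof -
  have "f \<in> fun_space.span S \<and> P f"
    using assms(1)
  proof (induction rule: fun_space.span_induct_alt)
    case base
    then show ?case using assms(2) fun_space.span_zero[of S] by (simp add: zero_fun_def)
  next
    case (step c \<phi> g)
    then have "(\<lambda>x. c * \<phi> x) \<in> fun_space.span S"
      using fun_space.span_scale[OF fun_space.span_base] by blast
    then show ?case
      using step assms(3)[of \<phi> g c] fun_span_add[of "\<lambda>x. c * \<phi> x" S g] by (simp add: plus_fun_def)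
  qed
  then show ?thesis ..
qed

lemma fun_span_zero: "(\<lambda>x. 0) \<in> fun_space.span S"
  using fun_space.span_zero[of S] by (simp add: zero_fun_def)

lemma fun_span_sum:
  assumes "\<And>i. i \<in> I \<Longrightarrow> f i \<in> fun_space.span S"
  shows "(\<lambda>x. \<Sum>i\<in>I. f i x) \<in> fun_space.span S"
  using assms
  by (induction I rule: infinite_finite_induct) (auto intro: fun_span_zero fun_span_add)

lemma fun_span_mult:
  assumes "f \<in> fun_space.span S" "\<And>\<phi>. \<phi> \<in> S \<Longrightarrow> (\<lambda>x. \<phi> x * g x) \<in> fun_space.span S'"
  shows "(\<lambda>x. f x * g x) \<in> fun_space.span S'"
  using assms(1)
proof (induction rule: fun_span_induct)
  case zero
  then show ?case by (simp add: fun_span_zero)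
next
  case (step c \<phi> h)
  have "(\<lambda>x. c * (\<phi> x * g x)) \<in> fun_space.span S'"
    using fun_space.span_scale[OF assms(2)] step by blast
  from fun_span_add[OF this step(3)] show ?case by (simp add: algebra_simps)
qed

definition trig_coords :: "(torus3 \<Rightarrow> real) set"
  where "trig_coords = range (\<lambda>i p. circle_cos (p $ i)) \<union> range (\<lambda>i p. circle_sin (p $ i))"

text \<open>Products of at most \<open>n\<close> coordinate functions \<open>cos x\<^sub>i\<close>, \<open>sin x\<^sub>i\<close>. Generating them by degree
keeps each stage finite and its span invariant under differentiation.\<close>

primrec trig_monomials :: "nat \<Rightarrow> (torus3 \<Rightarrow> real) set" where
  "trig_monomials 0 = {\<lambda>p. 1}"
| "trig_monomials (Suc n) =
     trig_monomials n \<union> {\<lambda>p. \<phi> p * t p | \<phi> t. \<phi> \<in> trig_monomials n \<and> t \<in> trig_coords}"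

definition trig_polys :: "(torus3 \<Rightarrow> real) set"
  where "trig_polys = fun_space.span (\<Union>n. trig_monomials n)"

lemma finite_trig_monomials: "finite (trig_monomials n)"
proof (induction n)
  case (Suc n)
  have "{\<lambda>p. \<phi> p * t p | \<phi> t. \<phi> \<in> trig_monomials n \<and> t \<in> trig_coords} =
      (\<lambda>(\<phi>, t) p. \<phi> p * t p) ` (trig_monomials n \<times> trig_coords)" by auto
  moreover have "finite trig_coords" by (simp add: trig_coords_def)
  ultimately show ?case using Suc by simp
qed simp

lemma trig_monomials_mono: "n \<le> m \<Longrightarrow> trig_monomials n \<subseteq> trig_monomials m"
  by (induction m rule: dec_induct) auto

lemma trig_monomials_smooth: "\<phi> \<in> trig_monomials n \<Longrightarrow> torus_smooth \<phi>"
proof (induction n arbitrary: \<phi>)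
  case 0
  then show ?case by (simp add: torus_smooth_const)
next
  case (Suc n)
  then show ?case using torus_smooth_cos_sin by (auto simp: trig_coords_def intro!: torus_smooth_mult)
qed

lemma fun_span_smooth:
  assumes "f \<in> fun_space.span S" "\<And>\<phi>. \<phi> \<in> S \<Longrightarrow> torus_smooth \<phi>"
  shows "torus_smooth f"
  using assms(1)
  by (induction rule: fun_span_induct)
    (use assms(2) torus_smooth_add torus_smooth_mult torus_smooth_const in \<open>blast+\<close>)

lemma trig_polys_smooth: "f \<in> trig_polys \<Longrightarrow> torus_smooth f"
  unfolding trig_polys_def using trig_monomials_smooth by (elim fun_span_smooth) blast

lemma trig_polys_filtered:
  assumes "f \<in> trig_polys" shows "\<exists>n. f \<in> fun_space.span (trig_monomials n)"
  using assms unfolding trig_polys_def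
proof (induction rule: fun_span_induct)
  case zero
  then show ?case using fun_span_zero by blast
next
  case (step c \<phi> g)
  then obtain n m where nm: "\<phi> \<in> trig_monomials n" "g \<in> fun_space.span (trig_monomials m)" by blast
  have "(\<lambda>p. c * \<phi> p) \<in> fun_space.span (trig_monomials (max n m))"
    using nm trig_monomials_mono[of n "max n m"] by (intro fun_space.span_scale fun_space.span_base) auto
  moreover have "g \<in> fun_space.span (trig_monomials (max n m))"
    using nm fun_space.span_mono[OF trig_monomials_mono[of m "max n m"]] by auto
  ultimately show ?case using fun_span_add by blast
qed

lemma span_trig_monomials_mono:
  "n \<le> m \<Longrightarrow> fun_space.span (trig_monomials n) \<subseteq> fun_space.span (trig_monomials m)"
  by (intro fun_space.span_mono trig_monomials_mono)

text \<open>Differentiation replaces one factor \<open>cos x\<^sub>i\<close> or \<open>sin x\<^sub>i\<close> by \<open>\<plusminus>\<close> the other one and so does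
not raise the degree.\<close>

lemma trig_monomials_partial:
  "\<phi> \<in> trig_monomials n \<Longrightarrow> torus_partial i \<phi> \<in> fun_space.span (trig_monomials n)"
proof (induction n arbitrary: \<phi>)
  case 0
  moreover have "torus_partial i (\<lambda>p. 1) = (\<lambda>p. 0)" using torus_partial_const by blast
  ultimately show ?case by (simp add: fun_span_zero)
next
  case (Suc n)
  have inc: "fun_space.span (trig_monomials n) \<subseteq> fun_space.span (trig_monomials (Suc n))"
    by (rule span_trig_monomials_mono) simp
  show ?case
  proof (cases "\<phi> \<in> trig_monomials n")
    case True
    then show ?thesis using Suc.IH inc by blast
  next
    case False
    then obtain \<psi> t where \<psi>: "\<psi> \<in> trig_monomials n" and t: "t \<in> trig_coords" and \<phi>: "\<phi> = (\<lambda>p. \<psi> p * t p)"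
      using Suc.prems by auto
    have d: "torus_differentiable \<psi>" "torus_differentiable t"
      using trig_monomials_smooth[OF \<psi>] t torus_smooth_cos_sin
      by (auto simp: trig_coords_def intro!: torus_smooth_imp_differentiable)
    have step: "(\<lambda>p. f p * u p) \<in> fun_space.span (trig_monomials (Suc n))"
      if "f \<in> fun_space.span (trig_monomials n)" "u \<in> trig_coords" for f u
      using that(1) by (rule fun_span_mult) (use that(2) in \<open>auto intro!: fun_space.span_base\<close>)
    have "(\<lambda>p. torus_partial i t p * \<psi> p) \<in> fun_space.span (trig_monomials (Suc n))"
    proof -
      consider j where "t = (\<lambda>p. circle_cos (p $ j))" | j where "t = (\<lambda>p. circle_sin (p $ j))"
        using t unfolding trig_coords_def by blast
      then obtain u c where u: "u \<in> trig_coords" "torus_partial i t = (\<lambda>p. c * u p)"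
      proof cases
        case 1
        then have "torus_partial i t = (\<lambda>p. (if i = j then -1 else 0) * circle_sin (p $ j))"
          by (auto simp: torus_partial_cos_sin)
        then show ?thesis using that unfolding trig_coords_def by blast
      next
        case 2
        then have "torus_partial i t = (\<lambda>p. (if i = j then 1 else 0) * circle_cos (p $ j))"
          by (auto simp: torus_partial_cos_sin)
        then show ?thesis using that unfolding trig_coords_def by blast
      qed
      have "(\<lambda>p. c * (\<psi> p * u p)) \<in> fun_space.span (trig_monomials (Suc n))"
        using step[OF fun_space.span_base[OF \<psi>] u(1)] by (rule fun_space.span_scale)
      then show ?thesis by (simp add: u(2) mult_ac)
    qed
    note fun_span_add[OF step[OF Suc.IH[OF \<psi>] t] this]
    moreover have "torus_partial i \<phi> = (\<lambda>p. torus_partial i \<psi> p * t p + torus_partial i t p * \<psi> p)"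
      unfolding \<phi> using torus_partial_mult[OF d] by (simp add: fun_eq_iff mult.commute)
    ultimately show ?thesis by simp
  qed
qed

lemma torus_partial_scale:
  "torus_differentiable f \<Longrightarrow> torus_partial i (\<lambda>p. c * f p) p = c * torus_partial i f p"
  using torus_partial_mult[OF torus_differentiable_const, of f i c p] by (simp add: torus_partial_const)

lemma span_trig_monomials_partial:
  assumes "f \<in> fun_space.span (trig_monomials n)"
  shows "torus_partial i f \<in> fun_space.span (trig_monomials n)"
  using assms
proof (induction rule: fun_span_induct)
  case zero
  have "torus_partial i (\<lambda>p. 0) = (\<lambda>p. 0)" using torus_partial_const by blast
  then show ?case by (simp add: fun_span_zero)
next
  case (step c \<phi> g)
  have d: "torus_differentiable \<phi>" "torus_differentiable g"
    using step trig_monomials_smooth fun_span_smooth torus_smooth_imp_differentiable by metis+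
  have "torus_partial i (\<lambda>p. c * \<phi> p + g p) = (\<lambda>p. c * torus_partial i \<phi> p + torus_partial i g p)"
    using torus_partial_add[OF torus_differentiable_mult[OF torus_differentiable_const d(1)] d(2)]
      torus_partial_scale[OF d(1)] by (simp add: fun_eq_iff)
  moreover have "(\<lambda>p. c * torus_partial i \<phi> p) \<in> fun_space.span (trig_monomials n)"
    using trig_monomials_partial[OF step(1)] by (rule fun_space.span_scale)
  ultimately show ?case using fun_span_add step(3) by simp
qed

lemma trig_polys_const: "(\<lambda>p. c) \<in> trig_polys"
proof -
  have "(\<lambda>p. c * 1) \<in> trig_polys"
    unfolding trig_polys_def
    by (rule fun_space.span_scale[OF fun_space.span_base]) (auto intro!: exI[of _ 0])
  then show ?thesis by simp
qed

lemma trig_polys_add: "f \<in> trig_polys \<Longrightarrow> g \<in> trig_polys \<Longrightarrow> (\<lambda>p. f p + g p) \<in> trig_polys"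
  unfolding trig_polys_def by (rule fun_span_add)

lemma trig_polys_mult:
  assumes "f \<in> trig_polys" "g \<in> trig_polys" shows "(\<lambda>p. f p * g p) \<in> trig_polys"
proof -
  have coord: "(\<lambda>p. h p * t p) \<in> trig_polys" if "h \<in> trig_polys" "t \<in> trig_coords" for h t
    using that(1) unfolding trig_polys_def
  proof (rule fun_span_mult)
    fix \<phi> assume "\<phi> \<in> (\<Union>n. trig_monomials n)"
    then obtain n where "\<phi> \<in> trig_monomials n" by blast
    then have "(\<lambda>p. \<phi> p * t p) \<in> trig_monomials (Suc n)" using that(2) by auto
    then show "(\<lambda>p. \<phi> p * t p) \<in> fun_space.span (\<Union>n. trig_monomials n)"
      by (intro fun_space.span_base) blast
  qed
  have mono: "\<forall>h\<in>trig_polys. (\<lambda>p. \<phi> p * h p) \<in> trig_polys" if "\<phi> \<in> trig_monomials n" for \<phi> n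
    using that
  proof (induction n arbitrary: \<phi>)
    case (Suc n)
    show ?case
    proof (cases "\<phi> \<in> trig_monomials n")
      case False
      then obtain \<psi> t where \<psi>: "\<psi> \<in> trig_monomials n" "t \<in> trig_coords" "\<phi> = (\<lambda>p. \<psi> p * t p)"
        using Suc.prems by auto
      have "(\<lambda>p. \<psi> p * h p * t p) \<in> trig_polys" if "h \<in> trig_polys" for h
        using coord Suc.IH[OF \<psi>(1)] \<psi>(2) that by blast
      then show ?thesis by (simp add: \<psi>(3) mult_ac)
    qed (use Suc.IH in blast)
  qed simp
  show ?thesis
    using assms(1) unfolding trig_polys_def
    by (rule fun_span_mult) (use mono assms(2) trig_polys_def in blast)
qed

lemma trig_polys_sum:
  "(\<And>i. i \<in> I \<Longrightarrow> f i \<in> trig_polys) \<Longrightarrow> (\<lambda>p. \<Sum>i\<in>I. f i p) \<in> trig_polys"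
  unfolding trig_polys_def by (rule fun_span_sum)

lemma trig_monomials_polys: "\<phi> \<in> trig_monomials n \<Longrightarrow> \<phi> \<in> trig_polys"
  unfolding trig_polys_def by (rule fun_space.span_base) blast

lemma trig_coords_polys: "t \<in> trig_coords \<Longrightarrow> t \<in> trig_polys"
  by (rule trig_monomials_polys[of _ "Suc 0"]) auto

text \<open>The standard embedding into a Euclidean space, through which continuous functions on the torus are
approximated: polynomials on the target pull back to trigonometric polynomials.\<close>

definition torus_coords :: "torus3 \<Rightarrow> (real ^ 3) \<times> (real ^ 3)"
  where "torus_coords p = (\<chi> i. circle_cos (p $ i), \<chi> i. circle_sin (p $ i))"

lemma continuous_torus_coords: "continuous_on UNIV torus_coords"
  unfolding torus_coords_def
  by (intro continuous_on_Pair continuous_on_vec_lambda torus_smooth_imp_continuous torus_smooth_cos_sin)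

lemma inj_torus_coords: "inj torus_coords"
  by (rule injI) (auto simp: torus_coords_def vec_eq_iff intro: circle_eqI)

lemma polynomial_torus_coords:
  assumes "real_polynomial_function q" shows "(\<lambda>p. q (torus_coords p)) \<in> trig_polys"
  using assms
proof (induction rule: real_polynomial_function.induct)
  case (linear q)
  interpret bounded_linear q by (rule linear)
  have vec: "v = (\<Sum>i\<in>UNIV. v $ i *\<^sub>R axis i 1)" for v :: "real ^ 3"
    using basis_expansion[of v] by (simp add: scalar_mult_eq_scaleR)
  have e: "(u, v) = (\<Sum>i\<in>UNIV. u $ i *\<^sub>R (axis i 1, 0)) + (\<Sum>i\<in>UNIV. v $ i *\<^sub>R (0, axis i 1))"
    for u v :: "real ^ 3"
    using vec[of u] vec[of v] by (simp add: prod_eq_iff fst_sum snd_sum)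
  have q: "q (u, v) = (\<Sum>i\<in>UNIV. u $ i * q (axis i 1, 0)) + (\<Sum>i\<in>UNIV. v $ i * q (0, axis i 1))"
    for u v :: "real ^ 3"
    unfolding e[of u v] add sum scaleR by simp
  have trig: "(\<lambda>p. circle_cos (p $ i)) \<in> trig_polys" "(\<lambda>p. circle_sin (p $ i)) \<in> trig_polys" for i
    by (rule trig_coords_polys, simp add: trig_coords_def)+
  have "(\<lambda>p. circle_cos (p $ i) * c) \<in> trig_polys" "(\<lambda>p. circle_sin (p $ i) * c) \<in> trig_polys" for i c
    by (rule trig_polys_mult[OF trig(1) trig_polys_const], rule trig_polys_mult[OF trig(2) trig_polys_const])
  then have "(\<lambda>p. (\<Sum>i\<in>UNIV. circle_cos (p $ i) * q (axis i 1, 0)) +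
      (\<Sum>i\<in>UNIV. circle_sin (p $ i) * q (0, axis i 1))) \<in> trig_polys"
    by (intro trig_polys_add trig_polys_sum)
  moreover have "q (torus_coords p) = (\<Sum>i\<in>UNIV. circle_cos (p $ i) * q (axis i 1, 0)) +
      (\<Sum>i\<in>UNIV. circle_sin (p $ i) * q (0, axis i 1))" for p
    using q[of "\<chi> i. circle_cos (p $ i)" "\<chi> i. circle_sin (p $ i)"] by (simp only: torus_coords_def vec_lambda_beta)
  ultimately show ?case by simp
qed (auto intro: trig_polys_const trig_polys_add trig_polys_mult)

lemma trig_polys_uniformly_dense:
  assumes "continuous_on UNIV \<phi>" "0 < \<epsilon>"
  obtains t where "t \<in> trig_polys" "\<And>p. \<bar>\<phi> (torus_coords p) - t p\<bar> < \<epsilon>"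
proof -
  have "compact (range torus_coords)"
    by (rule compact_continuous_image[OF continuous_torus_coords compact_torus])
  then obtain q where "real_polynomial_function q" "\<And>x. x \<in> range torus_coords \<Longrightarrow> \<bar>\<phi> x - q x\<bar> < \<epsilon>"
    using Stone_Weierstrass_real_polynomial_function[of "range torus_coords" \<phi> \<epsilon>]
      continuous_on_subset[OF assms(1)] assms(2) by blast
  then show ?thesis using that[OF polynomial_torus_coords] by blast
qed

section \<open>Density of trigonometric polynomials in the square integrable functions\<close>

definition L2_approximable :: "(torus3 \<Rightarrow> real) \<Rightarrow> bool"
  where "L2_approximable f \<longleftrightarrow> torus_L2 f \<and>
    (\<forall>\<epsilon>>0. \<exists>t\<in>trig_polys. L2_inner (\<lambda>p. f p - t p) (\<lambda>p. f p - t p) < \<epsilon>)"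

lemma trig_polys_L2: "t \<in> trig_polys \<Longrightarrow> torus_L2 t"
  by (intro torus_L2_smooth trig_polys_smooth)

lemma L2_inner_zero [simp]: "L2_inner (\<lambda>p. 0) f = 0"
  by (simp add: L2_inner_def)

lemma L2_approximable_trig: "t \<in> trig_polys \<Longrightarrow> L2_approximable t"
  unfolding L2_approximable_def using trig_polys_L2 by (auto intro!: bexI[of _ t])

lemma L2_approximable_scale:
  assumes "L2_approximable f" shows "L2_approximable (\<lambda>p. c * f p)"
  unfolding L2_approximable_def
proof (intro conjI allI impI)
  show "torus_L2 (\<lambda>p. c * f p)" using assms torus_L2_scale by (auto simp: L2_approximable_def)
  fix \<epsilon> :: real assume "\<epsilon> > 0"
  have c: "c\<^sup>2 + 1 > 0" by (simp add: add_nonneg_pos)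
  with \<open>\<epsilon> > 0\<close> have "\<epsilon> / (c\<^sup>2 + 1) > 0" by (rule divide_pos_pos)
  then obtain t where t: "t \<in> trig_polys" "L2_inner (\<lambda>p. f p - t p) (\<lambda>p. f p - t p) < \<epsilon> / (c\<^sup>2 + 1)"
    using assms unfolding L2_approximable_def by blast
  have "L2_inner (\<lambda>p. c * f p - c * t p) (\<lambda>p. c * f p - c * t p) = c\<^sup>2 * L2_inner (\<lambda>p. f p - t p) (\<lambda>p. f p - t p)"
    by (simp only: right_diff_distrib[symmetric] L2_inner_scale power2_eq_square mult.assoc)
  also have "\<dots> \<le> (c\<^sup>2 + 1) * L2_inner (\<lambda>p. f p - t p) (\<lambda>p. f p - t p)"
    by (intro mult_right_mono L2_inner_nonneg) simp
  also have "\<dots> < \<epsilon>" using t(2) unfolding pos_less_divide_eq[OF c] by (simp only: mult.commute)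
  finally show "\<exists>s\<in>trig_polys. L2_inner (\<lambda>p. c * f p - s p) (\<lambda>p. c * f p - s p) < \<epsilon>"
    using trig_polys_mult[OF trig_polys_const t(1)] by (intro bexI[where x="\<lambda>p. c * t p"])
qed

lemma L2_approximable_add:
  assumes "L2_approximable f" "L2_approximable g" shows "L2_approximable (\<lambda>p. f p + g p)"
  unfolding L2_approximable_def
proof (intro conjI allI impI)
  have L: "torus_L2 f" "torus_L2 g" using assms by (auto simp: L2_approximable_def)
  then show "torus_L2 (\<lambda>p. f p + g p)" by (rule torus_L2_add)
  fix \<epsilon> :: real assume "\<epsilon> > 0"
  then have "\<epsilon> / 4 > 0" by simp
  then obtain t s where ts: "t \<in> trig_polys" "s \<in> trig_polys"
    "L2_inner (\<lambda>p. f p - t p) (\<lambda>p. f p - t p) < \<epsilon> / 4" "L2_inner (\<lambda>p. g p - s p) (\<lambda>p. g p - s p) < \<epsilon> / 4"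
    using assms unfolding L2_approximable_def by meson
  have e: "f p + g p - (t p + s p) = (f p - t p) + (g p - s p)" for p by simp
  have "L2_inner (\<lambda>p. f p + g p - (t p + s p)) (\<lambda>p. f p + g p - (t p + s p)) < \<epsilon>"
    unfolding e using ts L L2_inner_add_self_le[of "\<lambda>p. f p - t p" "\<lambda>p. g p - s p"]
    by (simp add: torus_L2_diff trig_polys_L2)
  then show "\<exists>u\<in>trig_polys. L2_inner (\<lambda>p. f p + g p - u p) (\<lambda>p. f p + g p - u p) < \<epsilon>"
    using trig_polys_add[OF ts(1,2)] by (intro bexI[where x="\<lambda>p. t p + s p"])
qed

lemma L2_approximable_sum:
  assumes "\<And>i. i \<in> I \<Longrightarrow> L2_approximable (f i)" shows "L2_approximable (\<lambda>p. \<Sum>i\<in>I. f i p)"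
  using assms
  by (induction I rule: infinite_finite_induct)
    (auto intro: L2_approximable_add L2_approximable_trig trig_polys_const)

text \<open>The single passage to the limit behind the following extensions, from continuous functions to
indicators of closed sets, then to disjoint unions, and from simple functions to all square
integrable ones.\<close>

lemma L2_approximable_dominated_limit:
  assumes g: "\<And>n. L2_approximable (g n)" and w: "torus_L2 w"
    and lim: "\<And>p. (\<lambda>n. g n p) \<longlonglongrightarrow> f p" and bound: "\<And>n p. \<bar>g n p\<bar> \<le> w p"
  shows "L2_approximable f"
proof -
  have gL: "torus_L2 (g n)" for n using g by (auto simp: L2_approximable_def)
  then have gm: "g n \<in> borel_measurable borel" for n using torus_L2_measurable by blast
  have fm: "f \<in> borel_measurable borel" using gm lim by (rule borel_measurable_LIMSEQ_real[rotated])
  have wf: "\<bar>f p\<bar> \<le> w p" for p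
    by (rule LIMSEQ_le_const2[OF tendsto_rabs[OF lim]]) (use bound in blast)
  have w2: "integrable torus_measure (\<lambda>p. (w p)\<^sup>2)" using w by (simp add: torus_L2_iff)
  have sq: "a\<^sup>2 \<le> b\<^sup>2" if "\<bar>a\<bar> \<le> b" for a b :: real
    using that by (simp add: abs_le_square_iff[symmetric])
  have f: "torus_L2 f"
    unfolding torus_L2_iff
  proof
    show "integrable torus_measure (\<lambda>p. (f p)\<^sup>2)"
      by (rule Bochner_Integration.integrable_bound[OF w2])
        (use fm sq[OF wf] in \<open>auto simp: measurable_cong_sets[OF sets_torus_measure refl]\<close>)
  qed (rule fm)
  have "(\<lambda>n. LINT p|torus_measure. (f p - g n p)\<^sup>2) \<longlonglongrightarrow> (LINT p|torus_measure. 0)"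
  proof (rule integral_dominated_convergence[where w="\<lambda>p. 4 * (w p)\<^sup>2"])
    show "integrable torus_measure (\<lambda>p. 4 * (w p)\<^sup>2)" using w2 by simp
    show "(\<lambda>p. (f p - g n p)\<^sup>2) \<in> borel_measurable torus_measure" for n
      using fm gm by (simp add: measurable_cong_sets[OF sets_torus_measure refl])
    have "(\<lambda>n. (f p - g n p)\<^sup>2) \<longlonglongrightarrow> 0" for p
      using tendsto_power[OF tendsto_diff[OF tendsto_const lim], of "f p" p 2] by simp
    then show "AE p in torus_measure. (\<lambda>n. (f p - g n p)\<^sup>2) \<longlonglongrightarrow> 0" by simp
    have "(f p - g n p)\<^sup>2 \<le> (2 * w p)\<^sup>2" for n p
      using wf[of p] bound[of n p] by (intro sq) linarith
    then show "AE p in torus_measure. norm ((f p - g n p)\<^sup>2) \<le> 4 * (w p)\<^sup>2" for n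
      by (simp add: power_mult_distrib)
  qed simp
  then have lim0: "(\<lambda>n. L2_inner (\<lambda>p. f p - g n p) (\<lambda>p. f p - g n p)) \<longlonglongrightarrow> 0"
    by (simp add: L2_inner_self)
  show ?thesis
    unfolding L2_approximable_def
  proof (intro conjI allI impI f)
    fix \<epsilon> :: real assume "\<epsilon> > 0"
    then have \<epsilon>: "\<epsilon> / 4 > 0" by simp
    obtain n where n: "L2_inner (\<lambda>p. f p - g n p) (\<lambda>p. f p - g n p) < \<epsilon> / 4"
      using order_tendstoD(2)[OF lim0 \<epsilon>] eventually_happens by force
    obtain t where t: "t \<in> trig_polys" "L2_inner (\<lambda>p. g n p - t p) (\<lambda>p. g n p - t p) < \<epsilon> / 4"
      using g[of n] \<epsilon> unfolding L2_approximable_def by blast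
    have "L2_inner (\<lambda>p. f p - t p) (\<lambda>p. f p - t p) < \<epsilon>"
      using L2_inner_triangle[OF f gL[of n] trig_polys_L2[OF t(1)]] n t(2) by linarith
    then show "\<exists>t\<in>trig_polys. L2_inner (\<lambda>p. f p - t p) (\<lambda>p. f p - t p) < \<epsilon>" using t(1) by blast
  qed
qed

lemma L2_approximable_continuous:
  assumes "continuous_on UNIV \<phi>"
  shows "L2_approximable (\<lambda>p. \<phi> (torus_coords p))"
  unfolding L2_approximable_def
proof (intro conjI allI impI)
  have c: "continuous_on UNIV (\<lambda>p. \<phi> (torus_coords p))"
    by (rule continuous_on_compose2[OF assms continuous_torus_coords]) simp
  then show "torus_L2 (\<lambda>p. \<phi> (torus_coords p))" by (rule torus_L2_continuous)
  fix \<epsilon> :: real assume "\<epsilon> > 0"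
  define m where "m = measure torus_measure UNIV"
  define \<delta> where "\<delta> = sqrt (\<epsilon> / (m + 1))"
  have m: "m \<ge> 0" by (simp add: m_def)
  then have \<delta>: "\<delta> > 0" using \<open>\<epsilon> > 0\<close> by (simp add: \<delta>_def)
  then obtain t where t: "t \<in> trig_polys" "\<And>p. \<bar>\<phi> (torus_coords p) - t p\<bar> < \<delta>"
    using trig_polys_uniformly_dense[OF assms] by blast
  have "L2_inner (\<lambda>p. \<phi> (torus_coords p) - t p) (\<lambda>p. \<phi> (torus_coords p) - t p) \<le> \<delta>\<^sup>2 * m"
    unfolding m_def
    using t(2) borel_measurable_continuous_onI[OF c] torus_L2_measurable[OF trig_polys_L2[OF t(1)]]
    by (intro L2_inner_bounded) (auto intro: less_imp_le)
  also have "\<delta>\<^sup>2 = \<epsilon> / (m + 1)" using m \<open>\<epsilon> > 0\<close> by (simp add: \<delta>_def)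
  also have "\<epsilon> / (m + 1) * m < \<epsilon>" using m \<open>\<epsilon> > 0\<close> by (simp add: field_simps)
  finally show "\<exists>t\<in>trig_polys. L2_inner (\<lambda>p. \<phi> (torus_coords p) - t p) (\<lambda>p. \<phi> (torus_coords p) - t p) < \<epsilon>"
    using t(1) by blast
qed

text \<open>The indicator of \<open>C\<close> is the limit of the continuous cut-offs \<open>max 0 (1 - n d)\<close>, where \<open>d\<close> is the
distance to the image of \<open>C\<close> under the embedding; that image is closed because \<open>C\<close> is compact.\<close>

lemma L2_approximable_closed:
  assumes "closed C" shows "L2_approximable (indicator C)"
proof (cases "C = {}")
  case True
  then show ?thesis using L2_approximable_trig[OF trig_polys_const[of 0]] by (simp add: indicator_def[abs_def])
next
  case False
  define D where "D = torus_coords ` C"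
  have "compact C" using compact_torus assms compact_Int_closed[of UNIV C] by simp
  then have "closed D" unfolding D_def
    by (intro compact_imp_closed compact_continuous_image continuous_on_subset[OF continuous_torus_coords]) auto
  define g where "g n x = max 0 (1 - real n * infdist x D)" for n x
  show ?thesis
  proof (rule L2_approximable_dominated_limit[of "\<lambda>n p. g n (torus_coords p)" "\<lambda>p. 1"])
    show "L2_approximable (\<lambda>p. g n (torus_coords p))" for n
      unfolding g_def by (intro L2_approximable_continuous continuous_intros)
    show "torus_L2 (\<lambda>p. 1)" by (intro torus_L2_continuous continuous_intros)
    show "\<bar>g n (torus_coords p)\<bar> \<le> 1" for n p unfolding g_def by (auto simp: infdist_nonneg)
    show "(\<lambda>n. g n (torus_coords p)) \<longlonglongrightarrow> indicator C p" for p
    proof (cases "p \<in> C")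
      case True
      then show ?thesis by (simp add: g_def D_def)
    next
      case False
      then have "torus_coords p \<notin> D" unfolding D_def using inj_torus_coords by (auto dest: injD)
      then have d: "infdist (torus_coords p) D > 0"
        using in_closed_iff_infdist_zero[OF \<open>closed D\<close>] \<open>C \<noteq> {}\<close> infdist_nonneg[of "torus_coords p" D]
        unfolding D_def by (metis image_is_empty less_eq_real_def)
      obtain N where N: "1 < real N * infdist (torus_coords p) D" using reals_Archimedean3[OF d] by blast
      have "g n (torus_coords p) = 0" if "n \<ge> N" for n
      proof -
        have "real N * infdist (torus_coords p) D \<le> real n * infdist (torus_coords p) D"
          using that d by (intro mult_right_mono) auto
        with N show ?thesis by (simp add: g_def max_def)
      qed
      then have "\<forall>\<^sub>F n in sequentially. g n (torus_coords p) = indicator C p"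
        using False by (auto simp: eventually_sequentially)
      then show ?thesis by (rule tendsto_eventually)
    qed
  qed
qed

text \<open>Closed sets are stable under intersection and generate the Borel sets, so Dynkin's theorem
reduces the claim to complements and disjoint unions.\<close>

lemma L2_approximable_borel:
  assumes "A \<in> sets borel" shows "L2_approximable (indicator A)"
proof -
  have "Int_stable (Collect closed :: torus3 set set)" by (auto simp: Int_stable_def)
  moreover have "Collect closed \<subseteq> Pow (UNIV :: torus3 set)" by simp
  moreover have "A \<in> sigma_sets UNIV (Collect closed)"
    using assms by (simp add: borel_eq_closed)
  ultimately show ?thesis
  proof (induction rule: sigma_sets_induct_disjoint)
    case (basic A)
    then show ?case by (simp add: L2_approximable_closed)
  next
    case empty
    show ?case by (rule L2_approximable_closed) simp
  next
    case (compl A)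
    have "indicator (UNIV - A) = (\<lambda>p. 1 + (-1) * indicator A p :: real)"
      by (auto simp: indicator_def)
    then show ?case
      using L2_approximable_add[OF L2_approximable_trig[OF trig_polys_const[of 1]]
          L2_approximable_scale[OF compl(2), of "-1"]] by simp
  next
    case (union A)
    show ?case
    proof (rule L2_approximable_dominated_limit[of "\<lambda>n p. \<Sum>i<n. indicator (A i) p" "\<lambda>p. 1"])
      show "L2_approximable (\<lambda>p. \<Sum>i<n. indicator (A i) p)" for n
        using union by (intro L2_approximable_sum) auto
      show "torus_L2 (\<lambda>p. 1)" by (intro torus_L2_continuous continuous_intros)
      have "(\<Sum>i<n. indicator (A i) p) = (indicator (\<Union>i<n. A i) p :: real)" for n p
        using union(1) by (intro indicator_UN_disjoint[symmetric]) (auto simp: disjoint_family_on_def)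
      then show "\<bar>\<Sum>i<n. indicator (A i) p :: real\<bar> \<le> 1" for n p by (simp add: indicator_def)
      show "(\<lambda>n. \<Sum>i<n. indicator (A i) p :: real) \<longlonglongrightarrow> indicator (\<Union>i. A i) p" for p
        using LIMSEQ_indicator_UN[of A p] \<open>\<And>p n. (\<Sum>i<n. indicator (A i) p) = (indicator (\<Union>i<n. A i) p :: real)\<close>
        by simp
    qed
  qed
qed

lemma L2_approximable_iff: "L2_approximable f \<longleftrightarrow> torus_L2 f"
proof
  assume f: "torus_L2 f"
  obtain s where s: "\<And>i. simple_function torus_measure (s i)" "\<And>p. (\<lambda>i. s i p) \<longlonglongrightarrow> f p"
    "\<And>i p. \<bar>s i p\<bar> \<le> 2 * \<bar>f p\<bar>"
    using borel_measurable_implies_sequence_metric[of f torus_measure 0] torus_L2_measurable[OF f]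
    by (auto simp: measurable_cong_sets[OF sets_torus_measure refl])
  show "L2_approximable f"
  proof (rule L2_approximable_dominated_limit[OF _ _ s(2,3)])
    have "torus_L2 (\<lambda>p. \<bar>f p\<bar>)" using f by (simp add: torus_L2_iff borel_measurable_abs)
    then show "torus_L2 (\<lambda>p. 2 * \<bar>f p\<bar>)" by (rule torus_L2_scale)
    fix n
    have fin: "finite (range (s n))" using simple_functionD(1)[OF s(1)[of n]] by simp
    have "s n p = (\<Sum>y\<in>range (s n). y * indicator (s n -` {y}) p)" for p
    proof -
      have "(\<Sum>y\<in>range (s n). y * indicator (s n -` {y}) p) = (\<Sum>y\<in>range (s n). if y = s n p then y else 0)"
        by (intro sum.cong) (auto simp: indicator_def)
      then show ?thesis using fin by simp
    qed
    then have "s n = (\<lambda>p. \<Sum>y\<in>range (s n). y * indicator (s n -` {y}) p)" by blast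
    moreover have "s n -` {y} \<in> sets borel" for y
      using simple_functionD(2)[OF s(1)[of n], of "{y}"] by simp
    then have "L2_approximable (\<lambda>p. \<Sum>y\<in>range (s n). y * indicator (s n -` {y}) p)"
      by (intro L2_approximable_sum L2_approximable_scale L2_approximable_borel)
    ultimately show "L2_approximable (s n)" by simp
  qed
qed (simp add: L2_approximable_def)

lemma trig_polys_dense_L2:
  assumes "torus_L2 f" "0 < \<epsilon>"
  obtains t where "t \<in> trig_polys" "L2_inner (\<lambda>p. f p - t p) (\<lambda>p. f p - t p) < \<epsilon>"
  using assms L2_approximable_iff[of f] unfolding L2_approximable_def by blast

section \<open>Weak derivatives and the Sobolev space\<close>

text \<open>A function of norm zero vanishes almost everywhere. The functions here are not identified modulo
null sets, so this replaces definiteness of the inner product.\<close>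

lemma L2_inner_null:
  assumes "torus_L2 d" "torus_L2 w" "L2_inner d d = 0" shows "L2_inner w d = 0"
proof -
  have "AE p in torus_measure. (d p)\<^sup>2 = 0"
    using assms integral_nonneg_eq_0_iff_AE[of torus_measure "\<lambda>p. (d p)\<^sup>2"]
    by (simp add: torus_L2_iff L2_inner_self)
  then have "(LINT p|torus_measure. w p * d p) = (LINT p|torus_measure. 0)"
    by (intro Bochner_Integration.integral_cong_AE)
      (use torus_L2_integrable_mult[OF assms(2,1)] in auto)
  then show ?thesis by (simp add: L2_inner_def)
qed

lemma is_weak_partial_iff:
  "is_weak_partial i u g \<longleftrightarrow> (\<forall>\<phi>. torus_smooth \<phi> \<longrightarrow> L2_inner u (torus_partial i \<phi>) = - L2_inner g \<phi>)"
  by (simp add: is_weak_partial_def L2_inner_def)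

lemma is_weak_partial_smooth: "torus_smooth s \<Longrightarrow> is_weak_partial i s (torus_partial i s)"
  unfolding is_weak_partial_iff L2_inner_def using torus_integrate_by_parts by blast

lemma is_weak_partial_diff:
  assumes "torus_L2 u" "torus_L2 v" "torus_L2 g" "torus_L2 h"
    "is_weak_partial i u g" "is_weak_partial i v h"
  shows "is_weak_partial i (\<lambda>p. u p - v p) (\<lambda>p. g p - h p)"
  using assms by (simp add: is_weak_partial_iff L2_inner_diff torus_L2_smooth torus_smooth_partial)

text \<open>The difference of two weak derivatives is orthogonal to all smooth functions, in particular to
the dense trigonometric polynomials, and hence has norm zero.\<close>

lemma weak_partial_unique:
  assumes "torus_L2 g" "torus_L2 h" "is_weak_partial i u g" "is_weak_partial i u h"
  shows "L2_inner g g = L2_inner h h"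
proof -
  define d where "d p = g p - h p" for p
  have dL: "torus_L2 d" unfolding d_def by (rule torus_L2_diff[OF assms(1,2)])
  have orth: "L2_inner d t = 0" if "t \<in> trig_polys" for t
    unfolding d_def using assms that trig_polys_smooth[OF that]
    by (simp add: is_weak_partial_iff L2_inner_diff trig_polys_L2)
  have le: "L2_inner d d \<le> \<epsilon>" if "\<epsilon> > 0" for \<epsilon>
  proof -
    obtain t where t: "t \<in> trig_polys" "L2_inner (\<lambda>p. d p - t p) (\<lambda>p. d p - t p) < \<epsilon>"
      using trig_polys_dense_L2[OF dL \<open>\<epsilon> > 0\<close>] by blast
    have "L2_inner (\<lambda>p. d p - t p) (\<lambda>p. d p - t p) = L2_inner d d + L2_inner t t"
      using dL trig_polys_L2[OF t(1)] orth[OF t(1)]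
      by (simp add: L2_inner_diff torus_L2_diff L2_inner_commute[of t d])
    then show ?thesis using t(2) L2_inner_nonneg[of t] by linarith
  qed
  have "L2_inner d d = 0"
    using le[of "L2_inner d d / 2"] L2_inner_nonneg[of d] by linarith
  then have "L2_inner g d = 0" "L2_inner h d = 0" using L2_inner_null[OF dL] assms(1,2) by blast+
  then show ?thesis
    using assms(1,2) unfolding d_def by (simp add: L2_inner_diff L2_inner_commute[of h g])
qed

text \<open>The Sobolev norm is defined with an arbitrary choice of weak derivatives; by uniqueness it may be
computed with any others.\<close>

lemma H1_norm_eq:
  assumes "\<And>i. torus_L2 (G i)" "\<And>i. is_weak_partial i u (G i)"
  shows "H1_norm u = sqrt (L2_inner u u + (\<Sum>i\<in>UNIV. L2_inner (G i) (G i)))"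
proof -
  have "torus_L2 (weak_partial i u) \<and> is_weak_partial i u (weak_partial i u)" for i
    unfolding weak_partial_def by (rule someI[of _ "G i"]) (use assms in blast)
  then have "L2_inner (weak_partial i u) (weak_partial i u) = L2_inner (G i) (G i)" for i
    using weak_partial_unique assms by blast
  then show ?thesis unfolding H1_norm_def L2_inner_self by simp
qed

lemma torus_smooth_H1: "torus_smooth s \<Longrightarrow> s \<in> torus_H1"
  unfolding torus_H1_def
  using torus_L2_smooth torus_smooth_partial is_weak_partial_smooth by blast

section \<open>Trigonometric polynomials are dense in the Sobolev space\<close>

lemma fun_span_L2:
  assumes "f \<in> fun_space.span B" "\<And>b. b \<in> B \<Longrightarrow> torus_L2 b" shows "torus_L2 f"
  using assms(1)
proof (induction rule: fun_span_induct)
  case zero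
  show ?case by (rule torus_L2_continuous) simp
next
  case (step c \<phi> g)
  then show ?case using torus_L2_add[OF torus_L2_scale[OF assms(2)]] by blast
qed

text \<open>One Gram--Schmidt step per generator. A generator \<open>b\<close> may be redundant up to a null set; then
its remainder \<open>r\<close> after projection is orthogonal to everything and the coefficient \<open>0\<close>, which is
the value of the quotient by zero, is correct.\<close>

lemma L2_projection_exists:
  assumes "finite B" "\<And>b. b \<in> B \<Longrightarrow> torus_L2 b" "torus_L2 u"
  shows "\<exists>v\<in>fun_space.span B. \<forall>e\<in>fun_space.span B. L2_inner (\<lambda>p. u p - v p) e = 0"
  using assms
proof (induction B arbitrary: u rule: finite_induct)
  case empty
  then show ?case by (simp add: zero_fun_def L2_inner_def)
next
  case (insert b B)
  have BL: "\<And>b. b \<in> B \<Longrightarrow> torus_L2 b" and bL: "torus_L2 b" using insert.prems by auto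
  obtain v where v: "v \<in> fun_space.span B" "\<And>e. e \<in> fun_space.span B \<Longrightarrow> L2_inner (\<lambda>p. u p - v p) e = 0"
    using insert.IH[OF BL insert.prems(2)] by blast
  obtain q where q: "q \<in> fun_space.span B" "\<And>e. e \<in> fun_space.span B \<Longrightarrow> L2_inner (\<lambda>p. b p - q p) e = 0"
    using insert.IH[OF BL bL] by blast
  define r where "r p = b p - q p" for p
  note sL = fun_span_L2[OF _ BL]
  have rL: "torus_L2 r" unfolding r_def using bL sL[OF q(1)] by (rule torus_L2_diff)
  have dL: "torus_L2 (\<lambda>p. u p - v p)" using insert.prems(2) sL[OF v(1)] by (rule torus_L2_diff)
  define c where "c = L2_inner (\<lambda>p. u p - v p) r / L2_inner r r"
  have c: "c * L2_inner r r = L2_inner (\<lambda>p. u p - v p) r"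
    using L2_inner_null[OF rL dL] by (auto simp: c_def)
  have expand: "L2_inner (\<lambda>p. u p - (v p + c * r p)) e = L2_inner (\<lambda>p. u p - v p) e - c * L2_inner r e"
    if "torus_L2 e" for e
    using L2_inner_diff(1)[OF dL torus_L2_scale[OF rL, of c] that] by (simp add: L2_inner_scale diff_diff_eq)
  have orth: "L2_inner (\<lambda>p. u p - (v p + c * r p)) e = 0" if "e \<in> fun_space.span B" for e
    using expand[OF sL[OF that]] v(2)[OF that] q(2)[OF that] by (simp add: r_def[abs_def])
  have orthb: "L2_inner (\<lambda>p. u p - (v p + c * r p)) b = 0"
  proof -
    let ?d = "\<lambda>p. u p - (v p + c * r p)"
    have "torus_L2 ?d"
      using insert.prems(2) sL[OF v(1)] rL by (intro torus_L2_diff torus_L2_add torus_L2_scale)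
    then have "L2_inner ?d r = L2_inner ?d b - L2_inner ?d q"
      unfolding r_def by (intro L2_inner_diff bL sL[OF q(1)])
    moreover have "L2_inner ?d r = 0" using expand[OF rL] c by simp
    ultimately show ?thesis using orth[OF q(1)] by simp
  qed
  have inc: "fun_space.span B \<subseteq> fun_space.span (insert b B)" by (intro fun_space.span_mono) auto
  have "r \<in> fun_space.span (insert b B)"
    using fun_space.span_diff[OF fun_space.span_base[of b "insert b B"], of q] q(1) inc
    by (auto simp: r_def[abs_def] fun_diff_def)
  then have mem: "(\<lambda>p. v p + c * r p) \<in> fun_space.span (insert b B)"
    using v(1) inc by (intro fun_span_add fun_space.span_scale) auto
  have "L2_inner (\<lambda>p. u p - (v p + c * r p)) e = 0" if e: "e \<in> fun_space.span (insert b B)" for e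
  proof -
    obtain k where "e - (\<lambda>p. k * b p) \<in> fun_space.span B"
      using e unfolding fun_space.span_breakdown_eq by blast
    then have k: "(\<lambda>p. e p - k * b p) \<in> fun_space.span B" by (simp add: fun_diff_def)
    have eL: "torus_L2 e" using fun_span_L2[OF e] insert.prems by blast
    have "torus_L2 (\<lambda>p. u p - (v p + c * r p))"
      using insert.prems(2) sL[OF v(1)] rL by (intro torus_L2_diff torus_L2_add torus_L2_scale)
    then show ?thesis
      using orth[OF k] L2_inner_diff(2)[OF eL torus_L2_scale[OF bL, of k]] orthb by (simp add: L2_inner_scale)
  qed
  then show ?case by (intro bexI[OF _ mem] ballI)
qed

text \<open>Pythagoras: \<open>f - v\<close> is orthogonal to \<open>v - t\<close>.\<close>

lemma L2_projection_best:
  assumes "torus_L2 f" "v \<in> fun_space.span B" "t \<in> fun_space.span B" "\<And>b. b \<in> B \<Longrightarrow> torus_L2 b"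
    and orth: "\<And>e. e \<in> fun_space.span B \<Longrightarrow> L2_inner (\<lambda>p. f p - v p) e = 0"
  shows "L2_inner (\<lambda>p. f p - v p) (\<lambda>p. f p - v p) \<le> L2_inner (\<lambda>p. f p - t p) (\<lambda>p. f p - t p)"
proof -
  define d where "d p = f p - v p" for p
  define e where "e p = v p - t p" for p
  have L: "torus_L2 d" "torus_L2 e"
    unfolding d_def e_def using assms fun_span_L2 by (blast intro: torus_L2_diff)+
  have "e \<in> fun_space.span B"
    using fun_space.span_diff[OF assms(2,3)] by (simp add: e_def[abs_def] fun_diff_def)
  then have "L2_inner d e = 0" using orth by (simp add: d_def[abs_def])
  then have "L2_inner (\<lambda>p. d p + e p) (\<lambda>p. d p + e p) = L2_inner d d + L2_inner e e"
    using L by (simp add: L2_inner_add torus_L2_add L2_inner_commute[of e d])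
  then show ?thesis using L2_inner_nonneg[of e] by (simp add: d_def[abs_def] e_def)
qed

text \<open>Let \<open>v\<close> be the projection of \<open>u\<close> onto an invariant space. For \<open>e\<close> in that space,
\<open>\<langle>g\<^sub>i, e\<rangle> = - \<langle>u, \<partial>\<^sub>i e\<rangle> = - \<langle>v, \<partial>\<^sub>i e\<rangle> = \<langle>\<partial>\<^sub>i v, e\<rangle>\<close>, so \<open>\<partial>\<^sub>i v\<close> is the projection of the weak
derivative \<open>g\<^sub>i\<close>. If the space is large enough to contain good approximations of \<open>u\<close> and of all \<open>g\<^sub>i\<close>,
the projections are at least as good.\<close>

lemma trig_polys_dense_H1:
  assumes u: "torus_L2 u" and g: "\<And>i. torus_L2 (g i)" "\<And>i. is_weak_partial i u (g i)" and \<epsilon>: "0 < \<epsilon>"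
  obtains v where "v \<in> trig_polys" "L2_inner (\<lambda>p. u p - v p) (\<lambda>p. u p - v p) < \<epsilon>"
    "\<And>i. L2_inner (\<lambda>p. g i p - torus_partial i v p) (\<lambda>p. g i p - torus_partial i v p) < \<epsilon>"
proof -
  have appr: "\<exists>n. \<exists>t\<in>fun_space.span (trig_monomials n). L2_inner (\<lambda>p. f p - t p) (\<lambda>p. f p - t p) < \<epsilon>"
    if f: "torus_L2 f" for f
  proof -
    obtain t where t: "t \<in> trig_polys" "L2_inner (\<lambda>p. f p - t p) (\<lambda>p. f p - t p) < \<epsilon>"
      using trig_polys_dense_L2[OF f \<epsilon>] by blast
    obtain n where "t \<in> fun_space.span (trig_monomials n)" using trig_polys_filtered[OF t(1)] ..
    then show ?thesis using t(2) by (intro exI bexI)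
  qed
  obtain n t where t: "t \<in> fun_space.span (trig_monomials n)" "L2_inner (\<lambda>p. u p - t p) (\<lambda>p. u p - t p) < \<epsilon>"
    using appr[OF u] by blast
  define close where "close i n t \<longleftrightarrow> t \<in> fun_space.span (trig_monomials n) \<and>
    L2_inner (\<lambda>p. g i p - t p) (\<lambda>p. g i p - t p) < \<epsilon>" for i n t
  have "\<forall>i. \<exists>n t. close i n t"
    using appr[OF g(1)] unfolding close_def by blast
  then obtain N where "\<forall>i. \<exists>t. close i (N i) t" using choice[of "\<lambda>i n. \<exists>t. close i n t"] by blast
  then obtain s where "\<forall>i. close i (N i) (s i)" using choice[of "\<lambda>i. close i (N i)"] by blast
  then have s: "\<And>i. s i \<in> fun_space.span (trig_monomials (N i))"
    "\<And>i. L2_inner (\<lambda>p. g i p - s i p) (\<lambda>p. g i p - s i p) < \<epsilon>" unfolding close_def by blast+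
  define M where "M = n + (\<Sum>i\<in>UNIV. N i)"
  have "N i \<le> M" for i unfolding M_def by (intro trans_le_add2 member_le_sum) auto
  then have s': "s i \<in> fun_space.span (trig_monomials M)" for i
    using s(1)[of i] span_trig_monomials_mono by blast
  have t': "t \<in> fun_space.span (trig_monomials M)"
    using t(1) span_trig_monomials_mono[of n M] by (auto simp: M_def)
  have monL: "\<And>b. b \<in> trig_monomials M \<Longrightarrow> torus_L2 b"
    using trig_monomials_smooth torus_L2_smooth by blast
  have MS: "\<And>e. e \<in> fun_space.span (trig_monomials M) \<Longrightarrow> torus_smooth e"
    using fun_span_smooth trig_monomials_smooth by blast
  obtain v where v: "v \<in> fun_space.span (trig_monomials M)"
    "\<And>e. e \<in> fun_space.span (trig_monomials M) \<Longrightarrow> L2_inner (\<lambda>p. u p - v p) e = 0"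
    using L2_projection_exists[OF finite_trig_monomials monL u] by blast
  have eq: "L2_inner u e = L2_inner v e" if "e \<in> fun_space.span (trig_monomials M)" for e
    using v(2)[OF that] L2_inner_diff(1)[OF u fun_span_L2[OF v(1) monL] fun_span_L2[OF that monL]] by simp
  have "L2_inner (\<lambda>p. g i p - torus_partial i v p) e = 0" if e: "e \<in> fun_space.span (trig_monomials M)" for i e
  proof -
    have "L2_inner (g i) e = - L2_inner u (torus_partial i e)"
      using g(2)[of i] MS[OF e] by (simp add: is_weak_partial_iff)
    also have "\<dots> = - L2_inner v (torus_partial i e)"
      using eq[OF span_trig_monomials_partial[OF e]] by simp
    also have "\<dots> = L2_inner (torus_partial i v) e"
      using is_weak_partial_smooth[OF MS[OF v(1)], of i] MS[OF e] by (simp add: is_weak_partial_iff)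
    finally show ?thesis
      using L2_inner_diff(1)[OF g(1) torus_L2_smooth[OF torus_smooth_partial[OF MS[OF v(1)]]] torus_L2_smooth[OF MS[OF e]]]
      by simp
  qed
  then have "L2_inner (\<lambda>p. g i p - torus_partial i v p) (\<lambda>p. g i p - torus_partial i v p)
      \<le> L2_inner (\<lambda>p. g i p - s i p) (\<lambda>p. g i p - s i p)" for i
    by (intro L2_projection_best[OF g(1) span_trig_monomials_partial[OF v(1)] s' monL])
  moreover have "L2_inner (\<lambda>p. u p - v p) (\<lambda>p. u p - v p) \<le> L2_inner (\<lambda>p. u p - t p) (\<lambda>p. u p - t p)"
    by (rule L2_projection_best[OF u v(1) t' monL v(2)])
  moreover have "v \<in> trig_polys"
    using v(1) fun_space.span_mono[of "trig_monomials M" "\<Union>n. trig_monomials n"] unfolding trig_polys_def by blast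
  ultimately show ?thesis using that t(2) s(2) by (meson le_less_trans)
qed

text \<open>On a finite measure space uniform estimates of a function and its partial derivatives dominate
the Sobolev norm.\<close>

lemma dense_in_H1I:
  assumes S: "\<And>s. s \<in> S \<Longrightarrow> torus_smooth s"
    and approx: "\<And>v \<delta>. v \<in> trig_polys \<Longrightarrow> 0 < \<delta> \<Longrightarrow>
      \<exists>s\<in>S. \<forall>p. \<bar>v p - s p\<bar> \<le> \<delta> \<and> (\<forall>i. \<bar>torus_partial i v p - torus_partial i s p\<bar> \<le> \<delta>)"
  shows "dense_in_H1 S"
  unfolding dense_in_H1_def
proof (intro conjI ballI allI impI)
  show "S \<subseteq> torus_H1" using S torus_smooth_H1 by blast
  fix u and \<epsilon> :: real assume "u \<in> torus_H1" and \<epsilon>: "0 < \<epsilon>"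
  then have "torus_L2 u" "\<forall>i. \<exists>g. torus_L2 g \<and> is_weak_partial i u g" by (auto simp: torus_H1_def)
  then obtain g where u: "torus_L2 u" and g: "\<And>i. torus_L2 (g i)" "\<And>i. is_weak_partial i u (g i)" by metis
  define m where "m = measure torus_measure UNIV"
  have m: "m \<ge> 0" by (simp add: m_def)
  have "0 < \<epsilon>\<^sup>2 / 32" using \<epsilon> by simp
  then obtain v where v: "v \<in> trig_polys" "L2_inner (\<lambda>p. u p - v p) (\<lambda>p. u p - v p) < \<epsilon>\<^sup>2 / 32"
    "\<And>i. L2_inner (\<lambda>p. g i p - torus_partial i v p) (\<lambda>p. g i p - torus_partial i v p) < \<epsilon>\<^sup>2 / 32"
    by (rule trig_polys_dense_H1[OF u g]) blast
  \<comment> \<open>Four squared norms enter; each is at most \<open>2 (\<epsilon>\<^sup>2/32) + 2 \<delta>\<^sup>2 m \<le> \<epsilon>\<^sup>2/8\<close>.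
    The summand 1 covers the case \<open>m = 0\<close>.\<close>
  define \<delta> where "\<delta> = sqrt (\<epsilon>\<^sup>2 / 32 / (m + 1))"
  have \<delta>: "0 < \<delta>" using \<epsilon> m by (simp add: \<delta>_def)
  have "\<delta>\<^sup>2 = \<epsilon>\<^sup>2 / 32 / (m + 1)" using \<epsilon> m by (simp add: \<delta>_def)
  moreover have "m + 1 \<noteq> 0" using m by linarith
  ultimately have "\<delta>\<^sup>2 * (m + 1) = \<epsilon>\<^sup>2 / 32" by (metis nonzero_eq_divide_eq)
  then have \<delta>m: "\<delta>\<^sup>2 * m \<le> \<epsilon>\<^sup>2 / 32" using zero_le_power2[of \<delta>] unfolding distrib_left by linarith
  obtain s where s: "s \<in> S" "\<And>p. \<bar>v p - s p\<bar> \<le> \<delta>" "\<And>i p. \<bar>torus_partial i v p - torus_partial i s p\<bar> \<le> \<delta>"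
    using approx[OF v(1) \<delta>] by blast
  have bound: "L2_inner (\<lambda>p. f p - h p) (\<lambda>p. f p - h p) < \<epsilon>\<^sup>2 / 8"
    if "torus_L2 f" "torus_smooth w" "torus_smooth h"
      "L2_inner (\<lambda>p. f p - w p) (\<lambda>p. f p - w p) < \<epsilon>\<^sup>2 / 32" "\<And>p. \<bar>w p - h p\<bar> \<le> \<delta>" for f w h
  proof -
    note L = torus_L2_smooth[OF that(2)] torus_L2_smooth[OF that(3)]
    have "L2_inner (\<lambda>p. w p - h p) (\<lambda>p. w p - h p) \<le> \<delta>\<^sup>2 * m"
      unfolding m_def by (rule L2_inner_bounded[OF torus_L2_measurable[OF torus_L2_diff[OF L]] that(5)])
    then show ?thesis using L2_inner_triangle[OF that(1) L] that(4) \<delta>m by linarith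
  qed
  have 0: "L2_inner (\<lambda>p. u p - s p) (\<lambda>p. u p - s p) < \<epsilon>\<^sup>2 / 8"
    using bound[OF u trig_polys_smooth[OF v(1)] S[OF s(1)] v(2) s(2)] .
  have i: "L2_inner (\<lambda>p. g i p - torus_partial i s p) (\<lambda>p. g i p - torus_partial i s p) < \<epsilon>\<^sup>2 / 8" for i
    using bound[OF g(1) torus_smooth_partial[OF trig_polys_smooth[OF v(1)]] torus_smooth_partial[OF S[OF s(1)]] v(3) s(3)] .
  note sL = torus_L2_smooth[OF S[OF s(1)]] torus_L2_smooth[OF torus_smooth_partial[OF S[OF s(1)]]]
  have "H1_norm (\<lambda>p. u p - s p) = sqrt (L2_inner (\<lambda>p. u p - s p) (\<lambda>p. u p - s p) +
      (\<Sum>i\<in>UNIV. L2_inner (\<lambda>p. g i p - torus_partial i s p) (\<lambda>p. g i p - torus_partial i s p)))"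
    by (rule H1_norm_eq)
      (intro torus_L2_diff is_weak_partial_diff is_weak_partial_smooth g u sL S[OF s(1)])+
  also have "\<dots> < sqrt (\<epsilon>\<^sup>2)"
    unfolding real_sqrt_less_iff sum_3 using 0 i[of 1] i[of 2] i[of 3] zero_le_power2[of \<epsilon>] by linarith
  finally show "\<exists>s\<in>S. H1_norm (\<lambda>x. u x - s x) < \<epsilon>" using s(1) \<epsilon> by auto
qed

section \<open>Closed algebras of continuously differentiable functions\<close>

definition C1_close :: "real \<Rightarrow> (torus3 \<Rightarrow> real) \<Rightarrow> (torus3 \<Rightarrow> real) \<Rightarrow> bool"
  where "C1_close \<delta> f g \<longleftrightarrow>
    (\<forall>p. \<bar>f p - g p\<bar> \<le> \<delta> \<and> (\<forall>i. \<bar>torus_partial i f p - torus_partial i g p\<bar> \<le> \<delta>))"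

definition C1_bounded :: "real \<Rightarrow> (torus3 \<Rightarrow> real) \<Rightarrow> bool"
  where "C1_bounded K f \<longleftrightarrow> (\<forall>p. \<bar>f p\<bar> \<le> K \<and> (\<forall>i. \<bar>torus_partial i f p\<bar> \<le> K))"

text \<open>Only differentiability is asked of a limit, because compositions with continuously
differentiable functions of one variable are to belong to the closure.\<close>

definition C1_closure :: "(torus3 \<Rightarrow> real) set \<Rightarrow> (torus3 \<Rightarrow> real) set"
  where "C1_closure S = {f. torus_differentiable f \<and> (\<exists>K. C1_bounded K f) \<and>
    (\<forall>\<delta>>0. \<exists>g\<in>S. C1_close \<delta> f g)}"

definition smooth_algebra :: "(torus3 \<Rightarrow> real) set \<Rightarrow> bool"
  where "smooth_algebra S \<longleftrightarrow> (\<forall>f\<in>S. torus_smooth f) \<and> (\<forall>c. (\<lambda>p. c) \<in> S) \<and>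
    (\<forall>f\<in>S. \<forall>g\<in>S. (\<lambda>p. f p + g p) \<in> S \<and> (\<lambda>p. f p * g p) \<in> S)"

lemma C1_bounded_mono: "C1_bounded K f \<Longrightarrow> K \<le> K' \<Longrightarrow> C1_bounded K' f"
  unfolding C1_bounded_def by (meson order_trans)

lemma C1_bounded_nonneg: "C1_bounded K f \<Longrightarrow> 0 \<le> K"
  unfolding C1_bounded_def by (meson abs_ge_zero order_trans)

lemma torus_smooth_C1_bounded:
  assumes "torus_smooth f" shows "\<exists>K. C1_bounded K f"
proof -
  obtain K where K: "\<And>p. \<bar>f p\<bar> \<le> K"
    using torus_continuous_bounded[OF torus_smooth_imp_continuous[OF assms]] by blast
  have "\<forall>i. \<exists>K. \<forall>p. \<bar>torus_partial i f p\<bar> \<le> K"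
    using torus_continuous_bounded[OF torus_smooth_imp_continuous[OF torus_smooth_partial[OF assms]]] by meson
  then obtain N where N: "\<And>i p. \<bar>torus_partial i f p\<bar> \<le> N i" by metis
  have N0: "0 \<le> N i" for i using N[of i undefined] by linarith
  have "\<bar>f p\<bar> \<le> K + (\<Sum>i\<in>UNIV. N i)" for p
    using K[of p] sum_nonneg[of UNIV N] N0 by (simp add: add_increasing2)
  moreover have "\<bar>torus_partial i f p\<bar> \<le> K + (\<Sum>i\<in>UNIV. N i)" for i p
  proof -
    have "N i \<le> (\<Sum>i\<in>UNIV. N i)" using N0 by (intro member_le_sum) auto
    moreover have "0 \<le> K" using K[of p] by linarith
    ultimately show ?thesis using N[of i p] by linarith
  qed
  ultimately show ?thesis unfolding C1_bounded_def by blast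
qed

lemma C1_closureD:
  assumes "f \<in> C1_closure S" "0 < \<delta>" obtains g where "g \<in> S" "C1_close \<delta> f g"
  using assms unfolding C1_closure_def by blast

lemma C1_closure_base:
  assumes "smooth_algebra S" "f \<in> S" shows "f \<in> C1_closure S"
proof -
  have f: "torus_smooth f" using assms by (simp add: smooth_algebra_def)
  have "C1_close \<delta> f f" if "\<delta> > 0" for \<delta> using that by (simp add: C1_close_def)
  then show ?thesis
    unfolding C1_closure_def
    using torus_smooth_imp_differentiable[OF f] torus_smooth_C1_bounded[OF f] assms(2) by blast
qed

lemma C1_closure_const: "smooth_algebra S \<Longrightarrow> (\<lambda>p. c) \<in> C1_closure S"
  by (rule C1_closure_base) (simp_all add: smooth_algebra_def)

lemma C1_closure_closed:
  assumes "torus_differentiable f" "\<And>\<delta>. \<delta> > 0 \<Longrightarrow> \<exists>g\<in>C1_closure S. C1_close \<delta> f g"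
  shows "f \<in> C1_closure S"
  unfolding C1_closure_def
proof (intro CollectI conjI allI impI assms(1))
  have tri: "\<bar>a - c\<bar> \<le> d + e" if "\<bar>a - b\<bar> \<le> d" "\<bar>b - c\<bar> \<le> e" for a b c d e :: real
    using that by linarith
  obtain g K where g: "C1_close 1 f g" "C1_bounded K g"
    using assms(2)[of 1] unfolding C1_closure_def by auto
  have "\<bar>a\<bar> \<le> 1 + K" if "\<bar>a - b\<bar> \<le> 1" "\<bar>b\<bar> \<le> K" for a b :: real using that by linarith
  then have "C1_bounded (1 + K) f" using g unfolding C1_close_def C1_bounded_def by blast
  then show "\<exists>K. C1_bounded K f" ..
  fix \<delta> :: real assume "\<delta> > 0"
  then obtain g where g: "g \<in> C1_closure S" "C1_close (\<delta>/2) f g" using assms(2)[of "\<delta>/2"] by auto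
  then obtain h where h: "h \<in> S" "C1_close (\<delta>/2) g h"
    using C1_closureD[OF g(1), of "\<delta>/2"] \<open>\<delta> > 0\<close> by auto
  have "C1_close (\<delta>/2 + \<delta>/2) f h"
    using g(2) h(2) tri unfolding C1_close_def by blast
  then show "\<exists>h\<in>S. C1_close \<delta> f h" using h(1) by auto
qed

lemma C1_closure_add:
  assumes S: "smooth_algebra S" and f: "f \<in> C1_closure S" and g: "g \<in> C1_closure S"
  shows "(\<lambda>p. f p + g p) \<in> C1_closure S"
proof -
  have d: "torus_differentiable f" "torus_differentiable g" using f g by (auto simp: C1_closure_def)
  obtain K M where K: "C1_bounded K f" "C1_bounded M g" using f g by (auto simp: C1_closure_def)
  have b: "\<bar>x + y\<bar> \<le> K + M" if "\<bar>x\<bar> \<le> K" "\<bar>y\<bar> \<le> M" for x y :: real using that by linarith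
  show ?thesis
    unfolding C1_closure_def
  proof (intro CollectI conjI allI impI)
    show "torus_differentiable (\<lambda>p. f p + g p)" by (rule torus_differentiable_add[OF d])
    show "\<exists>K. C1_bounded K (\<lambda>p. f p + g p)"
      using K b unfolding C1_bounded_def torus_partial_add[OF d] by blast
    fix \<delta> :: real assume \<delta>: "\<delta> > 0"
    then have "\<delta>/2 > 0" by simp
    then obtain h k where hk: "h \<in> S" "k \<in> S" "C1_close (\<delta>/2) f h" "C1_close (\<delta>/2) g k"
      using C1_closureD[OF f] C1_closureD[OF g] by metis
    have d': "torus_differentiable h" "torus_differentiable k"
      using hk S by (auto simp: smooth_algebra_def torus_smooth_imp_differentiable)
    have "\<bar>(x + y) - (x' + y')\<bar> \<le> \<delta>" if "\<bar>x - x'\<bar> \<le> \<delta>/2" "\<bar>y - y'\<bar> \<le> \<delta>/2" for x y x' y' :: real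
      using that by linarith
    then have "C1_close \<delta> (\<lambda>p. f p + g p) (\<lambda>p. h p + k p)"
      using hk(3,4) unfolding C1_close_def torus_partial_add[OF d] torus_partial_add[OF d'] by blast
    moreover have "(\<lambda>p. h p + k p) \<in> S" using hk S by (simp add: smooth_algebra_def)
    ultimately show "\<exists>u\<in>S. C1_close \<delta> (\<lambda>p. f p + g p) u" by (rule bexI)
  qed
qed

lemma mult_close:
  fixes x y x' y' :: real
  assumes "\<bar>x\<bar> \<le> K" "\<bar>y\<bar> \<le> K" "\<bar>x - x'\<bar> \<le> \<eta>" "\<bar>y - y'\<bar> \<le> \<eta>" "\<eta> \<le> 1"
  shows "\<bar>x * y - x' * y'\<bar> \<le> (2 * K + 1) * \<eta>"
proof -
  have "\<bar>y'\<bar> \<le> K + 1" using assms by linarith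
  have "x * y - x' * y' = x * (y - y') + (x - x') * y'" by (simp add: algebra_simps)
  also have "\<bar>\<dots>\<bar> \<le> \<bar>x\<bar> * \<bar>y - y'\<bar> + \<bar>x - x'\<bar> * \<bar>y'\<bar>"
    using abs_triangle_ineq[of "x * (y - y')" "(x - x') * y'"] by (simp only: abs_mult)
  also have "\<dots> \<le> K * \<eta> + \<eta> * (K + 1)"
    using assms \<open>\<bar>y'\<bar> \<le> K + 1\<close> by (intro add_mono mult_mono) auto
  finally show ?thesis by (simp add: algebra_simps)
qed

lemma C1_closure_mult:
  assumes S: "smooth_algebra S" and f: "f \<in> C1_closure S" and g: "g \<in> C1_closure S"
  shows "(\<lambda>p. f p * g p) \<in> C1_closure S"
proof -
  have d: "torus_differentiable f" "torus_differentiable g" using f g by (auto simp: C1_closure_def)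
  obtain K1 K2 where "C1_bounded K1 f" "C1_bounded K2 g" using f g by (auto simp: C1_closure_def)
  then obtain K where K: "C1_bounded K f" "C1_bounded K g"
    using C1_bounded_mono[of K1 f "max K1 K2"] C1_bounded_mono[of K2 g "max K1 K2"] by auto
  have K0: "0 \<le> K" by (rule C1_bounded_nonneg[OF K(1)])
  have b: "\<bar>x * y\<bar> \<le> K * K" if "\<bar>x\<bar> \<le> K" "\<bar>y\<bar> \<le> K" for x y :: real
    unfolding abs_mult using that K0 by (intro mult_mono) auto
  have b2: "\<bar>x * y + z * w\<bar> \<le> 2 * (K * K)" if "\<bar>x\<bar> \<le> K" "\<bar>y\<bar> \<le> K" "\<bar>z\<bar> \<le> K" "\<bar>w\<bar> \<le> K" for x y z w :: real
    using b[OF that(1,2)] b[OF that(3,4)] by linarith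
  have b1: "\<bar>x * y\<bar> \<le> 2 * (K * K)" if "\<bar>x\<bar> \<le> K" "\<bar>y\<bar> \<le> K" for x y :: real
    using b[OF that] K0 mult_nonneg_nonneg[OF K0 K0] by linarith
  show ?thesis
    unfolding C1_closure_def
  proof (intro CollectI conjI allI impI)
    show "torus_differentiable (\<lambda>p. f p * g p)" by (rule torus_differentiable_mult[OF d])
    have "C1_bounded (2 * (K * K)) (\<lambda>p. f p * g p)"
      using K unfolding C1_bounded_def torus_partial_mult[OF d] by (auto intro!: b1 b2)
    then show "\<exists>K. C1_bounded K (\<lambda>p. f p * g p)" ..
    fix \<delta> :: real assume \<delta>: "\<delta> > 0"
    \<comment> \<open>A partial derivative of the product is a sum of two products, each off by at most
      \<open>(2 K + 1) \<eta>\<close>.\<close>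
    define \<eta> where "\<eta> = min 1 (\<delta> / (4 * K + 2))"
    have \<eta>: "0 < \<eta>" "\<eta> \<le> 1" using \<delta> K0 by (auto simp: \<eta>_def)
    have "\<eta> \<le> \<delta> / (4 * K + 2)" by (simp add: \<eta>_def)
    then have "\<eta> * (4 * K + 2) \<le> \<delta>" using K0 by (simp add: pos_le_divide_eq)
    then have le: "2 * ((2 * K + 1) * \<eta>) \<le> \<delta>" by (simp add: algebra_simps)
    have le1: "(2 * K + 1) * \<eta> \<le> \<delta>" using le mult_nonneg_nonneg[of "2 * K + 1" \<eta>] K0 \<eta> by linarith
    obtain h k where hk: "h \<in> S" "k \<in> S" "C1_close \<eta> f h" "C1_close \<eta> g k"
      using C1_closureD[OF f \<eta>(1)] C1_closureD[OF g \<eta>(1)] by metis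
    have d': "torus_differentiable h" "torus_differentiable k"
      using hk S by (auto simp: smooth_algebra_def torus_smooth_imp_differentiable)
    have c1: "\<bar>x * y - x' * y'\<bar> \<le> \<delta>"
      if "\<bar>x\<bar> \<le> K" "\<bar>y\<bar> \<le> K" "\<bar>x - x'\<bar> \<le> \<eta>" "\<bar>y - y'\<bar> \<le> \<eta>" for x y x' y' :: real
      using mult_close[OF that \<eta>(2)] le1 by linarith
    have c2: "\<bar>(x * y + z * w) - (x' * y' + z' * w')\<bar> \<le> \<delta>"
      if "\<bar>x\<bar> \<le> K" "\<bar>y\<bar> \<le> K" "\<bar>x - x'\<bar> \<le> \<eta>" "\<bar>y - y'\<bar> \<le> \<eta>"
        "\<bar>z\<bar> \<le> K" "\<bar>w\<bar> \<le> K" "\<bar>z - z'\<bar> \<le> \<eta>" "\<bar>w - w'\<bar> \<le> \<eta>" for x y x' y' z w z' w' :: real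
      using mult_close[OF that(1-4) \<eta>(2)] mult_close[OF that(5-8) \<eta>(2)] le by linarith
    have "C1_close \<delta> (\<lambda>p. f p * g p) (\<lambda>p. h p * k p)"
      using hk(3,4) K unfolding C1_close_def C1_bounded_def torus_partial_mult[OF d] torus_partial_mult[OF d']
      by (intro allI conjI c1 c2) blast+
    moreover have "(\<lambda>p. h p * k p) \<in> S" using hk S by (simp add: smooth_algebra_def)
    ultimately show "\<exists>u\<in>S. C1_close \<delta> (\<lambda>p. f p * g p) u" by (rule bexI)
  qed
qed

lemma C1_closure_polynomial:
  assumes S: "smooth_algebra S" and f: "f \<in> C1_closure S" and "real_polynomial_function q"
  shows "(\<lambda>p. q (f p)) \<in> C1_closure S"
  using assms(3)
proof (induction rule: real_polynomial_function.induct)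
  case (linear q)
  have "q x = x * q 1" for x using linear_cmul[OF bounded_linear.linear[OF linear], of x 1] by simp
  then have "(\<lambda>p. q (f p)) = (\<lambda>p. f p * q 1)" by blast
  then show ?case using C1_closure_mult[OF S f C1_closure_const[OF S, of "q 1"]] by simp
qed (auto intro: C1_closure_const[OF S] C1_closure_add[OF S] C1_closure_mult[OF S])

lemma real_polynomial_antiderivative:
  fixes q' :: "real \<Rightarrow> real"
  assumes "real_polynomial_function q'"
  shows "\<exists>q. real_polynomial_function q \<and> (\<forall>x. (q has_real_derivative q' x) (at x))"
proof -
  obtain a n where q': "q' = (\<lambda>x. \<Sum>i\<le>n. a i * x ^ i)"
    using assms unfolding real_polynomial_function_iff_sum by blast
  define q where "q x = (\<Sum>i\<le>n. a i / real (Suc i) * x ^ Suc i)" for x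
  have "real_polynomial_function (\<lambda>x. a i / real (Suc i) * x ^ Suc i)" for i
    by (intro real_polynomial_function.intros(2,4) real_polynomial_function_power
        real_polynomial_function.intros(1) bounded_linear_ident)
  then have "real_polynomial_function q" unfolding q_def by (intro real_polynomial_function_sum) auto
  moreover have "((\<lambda>x. a i / real (Suc i) * x ^ Suc i) has_real_derivative a i * x ^ i) (at x)" for i x
    by (rule derivative_eq_intros refl | simp)+
  then have "(q has_real_derivative q' x) (at x)" for x
    unfolding q_def q' by (intro DERIV_sum)
  ultimately show ?thesis by blast
qed

text \<open>A polynomial close to \<open>h'\<close> on the range of \<open>f\<close> has an antiderivative close to \<open>h\<close> there; composing
\<open>f\<close> with this polynomial antiderivative stays in the algebra and is \<open>C\<^sup>1\<close>-close to \<open>h \<circ> f\<close>.\<close>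

lemma C1_closure_compose:
  fixes h h' :: "real \<Rightarrow> real"
  assumes S: "smooth_algebra S" and f: "f \<in> C1_closure S"
    and range: "\<And>p. \<alpha> \<le> f p" "\<And>p. f p \<le> \<beta>"
    and h: "\<And>y. \<alpha> \<le> y \<Longrightarrow> y \<le> \<beta> \<Longrightarrow> (h has_real_derivative h' y) (at y)"
    and h': "continuous_on {\<alpha>..\<beta>} h'"
  shows "(\<lambda>p. h (f p)) \<in> C1_closure S"
proof (rule C1_closure_closed)
  have d: "torus_differentiable f" using f by (simp add: C1_closure_def)
  have hd: "(h has_real_derivative h' (f p)) (at (f p))" for p using h range by blast
  show "torus_differentiable (\<lambda>p. h (f p))" by (rule torus_chain(1)[where h' = h', OF d hd])
  obtain K where K: "C1_bounded K f" using f by (auto simp: C1_closure_def)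
  have K0: "0 \<le> K" by (rule C1_bounded_nonneg[OF K])
  have ab: "\<alpha> \<le> \<beta>" using range(1)[of undefined] range(2)[of undefined] by linarith
  fix \<delta> :: real assume \<delta>: "\<delta> > 0"
  \<comment> \<open>Integrating the error of \<open>h'\<close> over the range of \<open>f\<close> costs a factor \<open>\<beta> - \<alpha>\<close>, the chain rule a
    factor \<open>K\<close>.\<close>
  define \<eta> where "\<eta> = \<delta> / (K + (\<beta> - \<alpha>) + 1)"
  have \<eta>: "0 < \<eta>" using \<delta> K0 ab by (simp add: \<eta>_def)
  have \<eta>': "\<eta> * (K + (\<beta> - \<alpha>) + 1) = \<delta>" using K0 ab by (simp add: \<eta>_def)
  then have le: "\<eta> * K \<le> \<delta>" "\<eta> * (\<beta> - \<alpha>) \<le> \<delta>"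
    using \<eta> mult_nonneg_nonneg[of \<eta> K] mult_nonneg_nonneg[of \<eta> "\<beta> - \<alpha>"] K0 ab
    by (auto simp: distrib_left)
  obtain q' where q': "real_polynomial_function q'" "\<And>y. y \<in> {\<alpha>..\<beta>} \<Longrightarrow> \<bar>h' y - q' y\<bar> < \<eta>"
    using Stone_Weierstrass_real_polynomial_function[OF compact_Icc h' \<eta>] by blast
  obtain q where q: "real_polynomial_function q" "\<And>x. (q has_real_derivative q' x) (at x)"
    using real_polynomial_antiderivative[OF q'(1)] by blast
  define Q where "Q y = q y + (h \<alpha> - q \<alpha>)" for y
  have Qd: "(Q has_real_derivative q' y) (at y)" for y
    unfolding Q_def by (rule derivative_eq_intros q refl | simp)+
  have QC: "(\<lambda>p. Q (f p)) \<in> C1_closure S"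
    unfolding Q_def by (intro C1_closure_add[OF S] C1_closure_const[OF S] C1_closure_polynomial[OF S f q(1)])
  have close: "\<bar>h y - Q y\<bar> \<le> \<delta>" if y: "y \<in> {\<alpha>..\<beta>}" for y
  proof -
    have "norm ((h y - Q y) - (h \<alpha> - Q \<alpha>)) \<le> \<eta> * norm (y - \<alpha>)"
    proof (rule field_differentiable_bound[of "{\<alpha>..\<beta>}"])
      show "((\<lambda>y. h y - Q y) has_field_derivative h' z - q' z) (at z within {\<alpha>..\<beta>})" if "z \<in> {\<alpha>..\<beta>}" for z
        using that h Qd by (intro has_field_derivative_at_within[OF DERIV_diff]) auto
      show "norm (h' z - q' z) \<le> \<eta>" if "z \<in> {\<alpha>..\<beta>}" for z using q'(2)[OF that] by simp
    qed (use y ab in auto)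
    also have "\<dots> \<le> \<eta> * (\<beta> - \<alpha>)" using y \<eta> by (intro mult_left_mono) auto
    finally show ?thesis using le(2) by (simp add: Q_def)
  qed
  have "C1_close \<delta> (\<lambda>p. h (f p)) (\<lambda>p. Q (f p))"
    unfolding C1_close_def torus_chain(2)[where h' = h', OF d hd] torus_chain(2)[where h' = q', OF d Qd]
  proof (intro allI conjI)
    show "\<bar>h (f p) - Q (f p)\<bar> \<le> \<delta>" for p using close range by simp
    fix p i
    have "\<bar>h' (f p) - q' (f p)\<bar> * \<bar>torus_partial i f p\<bar> \<le> \<eta> * K"
      using q'(2)[of "f p"] range K \<eta> by (intro mult_mono) (auto simp: C1_bounded_def less_imp_le)
    then show "\<bar>h' (f p) * torus_partial i f p - q' (f p) * torus_partial i f p\<bar> \<le> \<delta>"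
      using le(1) by (simp only: abs_mult left_diff_distrib[symmetric])
  qed
  then show "\<exists>g\<in>C1_closure S. C1_close \<delta> (\<lambda>p. h (f p)) g" using QC by (rule bexI)
qed

lemma C1_closure_inverse_sqrt:
  assumes S: "smooth_algebra S" and f: "f \<in> C1_closure S" and \<alpha>: "0 < \<alpha>" "\<And>p. \<alpha> \<le> f p"
  shows "(\<lambda>p. inverse (f p)) \<in> C1_closure S" "(\<lambda>p. sqrt (f p)) \<in> C1_closure S"
proof -
  obtain K where "C1_bounded K f" using f by (auto simp: C1_closure_def)
  then have K: "f p \<le> K" for p unfolding C1_bounded_def by (meson abs_le_D1)
  show "(\<lambda>p. inverse (f p)) \<in> C1_closure S"
  proof (rule C1_closure_compose[OF S f \<alpha>(2) K])
    show "(inverse has_real_derivative - (inverse y ^ Suc (Suc 0))) (at y)" if "\<alpha> \<le> y" for y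
      using DERIV_inverse[of y UNIV] that \<alpha>(1) by simp
    show "continuous_on {\<alpha>..K} (\<lambda>y. - (inverse y ^ Suc (Suc 0)))"
      using \<alpha>(1) by (intro continuous_intros) auto
  qed
  show "(\<lambda>p. sqrt (f p)) \<in> C1_closure S"
  proof (rule C1_closure_compose[OF S f \<alpha>(2) K])
    show "(sqrt has_real_derivative inverse (sqrt y) / 2) (at y)" if "\<alpha> \<le> y" for y
      using DERIV_real_sqrt[of y] that \<alpha>(1) by simp
    show "continuous_on {\<alpha>..K} (\<lambda>y. inverse (sqrt y) / 2)"
      using \<alpha>(1) by (intro continuous_intros) auto
  qed
qed

section \<open>Cubic saturation\<close>

text \<open>Polynomials in the products \<open>b\<^sub>j b\<^sub>k\<close>, that is, polynomials in \<open>b\<close> without terms of odd degree.\<close>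

inductive_set even_polys :: "(torus3 \<Rightarrow> real ^ 'm) \<Rightarrow> (torus3 \<Rightarrow> real) set"
  for b :: "torus3 \<Rightarrow> real ^ 'm" where
  const: "(\<lambda>p. c) \<in> even_polys b"
| pair: "(\<lambda>p. b p $ j * b p $ k) \<in> even_polys b"
| add: "f \<in> even_polys b \<Longrightarrow> g \<in> even_polys b \<Longrightarrow> (\<lambda>p. f p + g p) \<in> even_polys b"
| mult: "f \<in> even_polys b \<Longrightarrow> g \<in> even_polys b \<Longrightarrow> (\<lambda>p. f p * g p) \<in> even_polys b"

lemma smooth_algebra_even_polys:
  assumes "\<And>j. torus_smooth (\<lambda>p. b p $ j)" shows "smooth_algebra (even_polys b)"
proof -
  have "torus_smooth f" if "f \<in> even_polys b" for f
    using that by induction (intro torus_smooth_const torus_smooth_add torus_smooth_mult assms; assumption?)+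
  then show ?thesis unfolding smooth_algebra_def using even_polys.intros by blast
qed

text \<open>One step of the cubic construction multiplies by a generator \<open>b\<^sub>j b\<^sub>k\<close> of the even polynomials.\<close>

lemma cubic_span_mult_even:
  assumes "f \<in> even_polys b" "\<phi> \<in> cubic_span b" shows "(\<lambda>p. \<phi> p * f p) \<in> cubic_span b"
  using assms
proof (induction arbitrary: \<phi> rule: even_polys.induct)
  case (const c)
  then show ?case
    using fun_space.span_scale[of \<phi> _ c] unfolding cubic_span_def by (simp add: mult.commute)
next
  case (pair j k)
  have step: "(\<lambda>p. \<psi> p * (b p $ j * b p $ k)) \<in> fun_space.span (\<Union>n. cubic_set b n)"
    if \<psi>: "\<psi> \<in> (\<Union>n. cubic_set b n)" for \<psi>
  proof -
    obtain n where "\<psi> \<in> cubic_set b n" using \<psi> by blast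
    then have "(\<lambda>p. \<psi> p * b p $ j * b p $ k) \<in> cubic_set b (Suc n)" by auto
    then have "(\<lambda>p. \<psi> p * b p $ j * b p $ k) \<in> (\<Union>n. cubic_set b n)" by blast
    then show ?thesis using fun_space.span_base by (simp add: mult.assoc)
  qed
  show ?case using pair unfolding cubic_span_def by (rule fun_span_mult[OF _ step])
next
  case (add f g)
  then show ?case
    using fun_span_add[of "\<lambda>p. \<phi> p * f p" "\<Union>n. cubic_set b n" "\<lambda>p. \<phi> p * g p"]
    unfolding cubic_span_def by (simp add: distrib_left)
next
  case (mult f g)
  show ?case using mult.IH(2)[OF mult.IH(1)[OF mult.prems]] by (simp add: mult.assoc)
qed

lemma profile_in_cubic_span: "(\<lambda>p. b p $ k) \<in> cubic_span b"
proof -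
  have "(\<lambda>p. b p $ k) \<in> cubic_set b 0" by auto
  then show ?thesis unfolding cubic_span_def by (intro fun_space.span_base) blast
qed

lemma cubic_span_smooth:
  assumes "\<And>j. torus_smooth (\<lambda>p. b p $ j)" "s \<in> cubic_span b" shows "torus_smooth s"
proof -
  have "torus_smooth \<phi>" if "\<phi> \<in> cubic_set b n" for \<phi> n
    using that
  proof (induction n arbitrary: \<phi>)
    case 0
    then show ?case using assms(1) by auto
  next
    case (Suc n)
    then consider "\<phi> \<in> cubic_set b n" | \<psi> j k where "\<psi> \<in> cubic_set b n" "\<phi> = (\<lambda>p. \<psi> p * b p $ j * b p $ k)"
      by auto
    then show ?case
    proof cases
      case 2
      then show ?thesis by (simp only:) (intro torus_smooth_mult Suc.IH assms(1))
    qed (rule Suc.IH)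
  qed
  then show ?thesis using assms(2) unfolding cubic_span_def by (elim fun_span_smooth) blast
qed

text \<open>With \<open>w = v / b\<^sub>k\<close> approximated by an even polynomial \<open>q\<close>, the odd polynomial \<open>b\<^sub>k q\<close> lies in the
cubic span and approximates \<open>b\<^sub>k w = v\<close>.\<close>

lemma cubic_span_C1_dense:
  assumes b: "\<And>j. torus_smooth (\<lambda>p. b p $ j)" and \<alpha>: "0 < \<alpha>" "\<And>p. \<alpha> \<le> b p $ k"
    and bk: "(\<lambda>p. b p $ k) \<in> C1_closure (even_polys b)"
    and v: "v \<in> C1_closure (even_polys b)" and \<delta>: "0 < \<delta>"
  shows "\<exists>s\<in>cubic_span b. C1_close \<delta> v s"
proof -
  note S = smooth_algebra_even_polys[of b, OF b]
  have bd: "torus_differentiable (\<lambda>p. b p $ k)" by (rule torus_smooth_imp_differentiable[OF b])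
  define w where "w p = v p * inverse (b p $ k)" for p
  have w: "w \<in> C1_closure (even_polys b)"
    unfolding w_def by (intro C1_closure_mult[OF S v] C1_closure_inverse_sqrt(1)[OF S bk \<alpha>])
  obtain K where K: "C1_bounded K (\<lambda>p. b p $ k)" using torus_smooth_C1_bounded[OF b] by blast
  have K0: "0 \<le> K" by (rule C1_bounded_nonneg[OF K])
  \<comment> \<open>The product rule gives two error terms of size \<open>K \<eta>\<close>; the summand 1 keeps the denominator
    positive.\<close>
  define \<eta> where "\<eta> = \<delta> / (2 * K + 1)"
  have \<eta>: "0 < \<eta>" using \<delta> K0 by (simp add: \<eta>_def)
  have "\<eta> * (2 * K + 1) = \<delta>" using K0 by (simp add: \<eta>_def)
  then have "2 * (K * \<eta>) + \<eta> = \<delta>" by (simp add: algebra_simps)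
  then have le: "2 * (K * \<eta>) \<le> \<delta>" "K * \<eta> \<le> \<delta>" using \<eta> mult_nonneg_nonneg[OF K0, of \<eta>] by linarith+
  obtain q where q: "q \<in> even_polys b" "C1_close \<eta> w q"
    by (rule C1_closureD[OF w \<eta>])
  have wd: "torus_differentiable w" "torus_differentiable q"
    using w q(1) S by (auto simp: C1_closure_def smooth_algebra_def torus_smooth_imp_differentiable)
  have vw: "v = (\<lambda>p. b p $ k * w p)"
  proof
    fix p
    have "b p $ k \<noteq> 0" using \<alpha>(1) \<alpha>(2)[of p] by linarith
    then show "v p = b p $ k * w p" by (simp add: w_def)
  qed
  have m: "\<bar>x * y - x * y'\<bar> \<le> K * \<eta>" if "\<bar>x\<bar> \<le> K" "\<bar>y - y'\<bar> \<le> \<eta>" for x y y' :: real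
    unfolding right_diff_distrib[symmetric] abs_mult using that K0 by (intro mult_mono) auto
  have m1: "\<bar>x * y - x * y'\<bar> \<le> \<delta>" if "\<bar>x\<bar> \<le> K" "\<bar>y - y'\<bar> \<le> \<eta>" for x y y' :: real
    using m[OF that] le(2) by linarith
  have m2: "\<bar>(x * y + z * u) - (x * y' + z * u')\<bar> \<le> \<delta>"
    if "\<bar>x\<bar> \<le> K" "\<bar>y - y'\<bar> \<le> \<eta>" "\<bar>z\<bar> \<le> K" "\<bar>u - u'\<bar> \<le> \<eta>" for x y y' z u u' :: real
    using m[OF that(1,2)] m[OF that(3,4)] le(1) by linarith
  have "C1_close \<delta> v (\<lambda>p. b p $ k * q p)"
    unfolding vw C1_close_def torus_partial_mult[OF bd wd(1)] torus_partial_mult[OF bd wd(2)]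
    using K q(2) unfolding C1_bounded_def C1_close_def by (intro allI conjI m1 m2) blast+
  then show ?thesis using cubic_span_mult_even[OF q(1) profile_in_cubic_span] by (rule bexI)
qed

lemma trig_polys_subset_C1_closure:
  assumes S: "smooth_algebra S" and coords: "trig_coords \<subseteq> C1_closure S"
  shows "trig_polys \<subseteq> C1_closure S"
proof
  have mono: "\<phi> \<in> C1_closure S" if "\<phi> \<in> trig_monomials n" for \<phi> n
    using that
  proof (induction n arbitrary: \<phi>)
    case 0
    then show ?case using C1_closure_const[OF S] by simp
  next
    case (Suc n)
    then show ?case using C1_closure_mult[OF S] coords by auto
  qed
  fix f assume "f \<in> trig_polys"
  then show "f \<in> C1_closure S"
    unfolding trig_polys_def
  proof (induction rule: fun_span_induct)
    case zero
    show ?case by (rule C1_closure_const[OF S])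
  next
    case (step c \<phi> g)
    then show ?case using mono by (intro C1_closure_add[OF S] C1_closure_mult[OF S] C1_closure_const[OF S]) auto
  qed
qed

text \<open>The radius is the square root of the sum of squares, and dividing by it leaves cosine and sine.\<close>

lemma explicit_polar_coords:
  assumes S: "smooth_algebra S" and \<alpha>: "0 < \<alpha>" "\<And>p. \<alpha> \<le> A p"
    and cl: "(\<lambda>p. A p * circle_cos (p $ i)) \<in> C1_closure S" "(\<lambda>p. A p * circle_sin (p $ i)) \<in> C1_closure S"
  shows "A \<in> C1_closure S" "(\<lambda>p. circle_cos (p $ i)) \<in> C1_closure S" "(\<lambda>p. circle_sin (p $ i)) \<in> C1_closure S"
proof -
  let ?x = "\<lambda>p. A p * circle_cos (p $ i)" and ?y = "\<lambda>p. A p * circle_sin (p $ i)"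
  have sq: "(\<lambda>p. ?x p * ?x p + ?y p * ?y p) \<in> C1_closure S"
    by (intro C1_closure_add[OF S] C1_closure_mult[OF S] cl)
  have e: "?x p * ?x p + ?y p * ?y p = (A p)\<^sup>2" for p
  proof -
    have "?x p * ?x p + ?y p * ?y p = (A p)\<^sup>2 * ((circle_cos (p $ i))\<^sup>2 + (circle_sin (p $ i))\<^sup>2)"
      by (simp add: algebra_simps power2_eq_square)
    then show ?thesis by (simp add: circle_cos_sin_sq)
  qed
  have pos: "0 < A p" for p using \<alpha>(1) \<alpha>(2)[of p] by linarith
  have "(\<lambda>p. sqrt ((A p)\<^sup>2)) \<in> C1_closure S"
    using \<alpha> by (intro C1_closure_inverse_sqrt(2)[OF S sq[unfolded e], of "\<alpha>\<^sup>2"]) (auto intro!: power_mono)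
  then show A: "A \<in> C1_closure S" using pos by (simp add: less_imp_le)
  note inv = C1_closure_inverse_sqrt(1)[OF S A \<alpha>]
  have "(\<lambda>p. ?x p * inverse (A p)) = (\<lambda>p. circle_cos (p $ i))" "(\<lambda>p. ?y p * inverse (A p)) = (\<lambda>p. circle_sin (p $ i))"
    using pos by (auto simp: fun_eq_iff field_simps less_imp_neq[symmetric])
  then show "(\<lambda>p. circle_cos (p $ i)) \<in> C1_closure S" "(\<lambda>p. circle_sin (p $ i)) \<in> C1_closure S"
    using C1_closure_mult[OF S cl(1) inv] C1_closure_mult[OF S cl(2) inv] by simp_all
qed

lemma explicit_saturating:
  assumes r: "0 < r" "r < R" "R + r < L"
  shows "cubically_saturating (explicit_profiles r R L)"
proof -
  define b where "b = explicit_profiles r R L"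
  have b: "torus_smooth (\<lambda>p. b p $ j)" for j unfolding b_def by (rule torus_smooth_explicit_nth)
  define C where "C = C1_closure (even_polys b)"
  note S = smooth_algebra_even_polys[of b, OF b]
  note const = C1_closure_const[OF S, folded C_def] and add = C1_closure_add[OF S, folded C_def]
    and mult = C1_closure_mult[OF S, folded C_def]
  define \<alpha> where "\<alpha> = L - (R + r)"
  have \<alpha>: "0 < \<alpha>" "\<And>p. \<alpha> \<le> b p $ 1"
    using r explicit_first_bounds(1)[OF r(1,2)] by (auto simp: \<alpha>_def b_def)
  have pair: "(\<lambda>p. b p $ j * b p $ k) \<in> C" for j k
    unfolding C_def by (rule C1_closure_base[OF S even_polys.pair])
  have b1: "(\<lambda>p. b p $ 1) \<in> C"
  proof -
    have "\<alpha> * \<alpha> \<le> b p $ 1 * b p $ 1" for p using \<alpha>(1) \<alpha>(2)[of p] by (intro mult_mono) auto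
    then have "(\<lambda>p. sqrt (b p $ 1 * b p $ 1)) \<in> C"
      using \<alpha>(1) pair unfolding C_def by (intro C1_closure_inverse_sqrt(2)[OF S, of _ "\<alpha> * \<alpha>"]) auto
    moreover have "sqrt (b p $ 1 * b p $ 1) = b p $ 1" for p using \<alpha>(1) \<alpha>(2)[of p] by simp
    ultimately show ?thesis by simp
  qed
  have bj: "(\<lambda>p. b p $ j) \<in> C" for j
  proof -
    have "(\<lambda>p. b p $ 1 * b p $ j * inverse (b p $ 1)) \<in> C"
      by (rule mult[OF pair C1_closure_inverse_sqrt(1)[OF S b1[unfolded C_def] \<alpha>, folded C_def]])
    moreover have "b p $ 1 * b p $ j * inverse (b p $ 1) = b p $ j" for p using \<alpha>(1) \<alpha>(2)[of p] by simp
    ultimately show ?thesis by simp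
  qed
  have pos: "0 < R - r" using r by simp
  \<comment> \<open>Removing the shift \<open>L\<close> uses that constants are even polynomials.\<close>
  have "(\<lambda>p. b p $ 1 + (- L)) \<in> C" by (intro add bj const)
  then have x1: "(\<lambda>p. (R + r * circle_cos (p $ 3)) * circle_cos (p $ 1)) \<in> C" by (simp add: b_def)
  have y1: "(\<lambda>p. (R + r * circle_cos (p $ 3)) * circle_sin (p $ 1)) \<in> C" using bj[of 2] by (simp add: b_def)
  have x2: "(\<lambda>p. (R + r * circle_sin (p $ 3)) * circle_cos (p $ 2)) \<in> C" using bj[of 3] by (simp add: b_def)
  have y2: "(\<lambda>p. (R + r * circle_sin (p $ 3)) * circle_sin (p $ 2)) \<in> C" using bj[of 4] by (simp add: b_def)
  note 1 = explicit_polar_coords[OF S pos explicit_radius_bounds(1)[OF r(1)], folded C_def, OF x1 y1]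
  note 2 = explicit_polar_coords[OF S pos explicit_radius_bounds(3)[OF r(1)], folded C_def, OF x2 y2]
  have "(\<lambda>p. (1 / r) * ((R + r * circle_cos (p $ 3)) + (- R))) \<in> C"
    "(\<lambda>p. (1 / r) * ((R + r * circle_sin (p $ 3)) + (- R))) \<in> C"
    by (intro mult add const 1(1) 2(1))+
  then have 3: "(\<lambda>p. circle_cos (p $ 3)) \<in> C" "(\<lambda>p. circle_sin (p $ 3)) \<in> C" using r(1) by simp_all
  have "\<forall>i. (\<lambda>p. circle_cos (p $ i)) \<in> C" "\<forall>i. (\<lambda>p. circle_sin (p $ i)) \<in> C"
    unfolding forall_3 using 1 2 3 by blast+
  then have trig: "trig_polys \<subseteq> C"
    unfolding C_def by (intro trig_polys_subset_C1_closure[OF S]) (auto simp: trig_coords_def)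
  show ?thesis
    unfolding cubically_saturating_def b_def[symmetric]
  proof (rule dense_in_H1I)
    show "torus_smooth s" if "s \<in> cubic_span b" for s using cubic_span_smooth[OF b that] .
    show "\<exists>s\<in>cubic_span b. \<forall>p. \<bar>v p - s p\<bar> \<le> \<delta> \<and> (\<forall>i. \<bar>torus_partial i v p - torus_partial i s p\<bar> \<le> \<delta>)"
      if "v \<in> trig_polys" "0 < \<delta>" for v \<delta>
      using cubic_span_C1_dense[OF b \<alpha> b1[unfolded C_def] _ that(2), of v] that(1) trig
      unfolding C_def C1_close_def by blast
  qed
qed

theorem proposition4p18:
  shows "(\<forall>b :: torus3 \<Rightarrow> real ^ 'm.
            torus_smooth b \<and> torus_smooth_embedding Sym_mats (Gamma_map b) \<longrightarrow> 4 \<le> CARD('m)) \<and>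
         (\<forall>r R L :: real. 0 < r \<and> r < R \<and> R + r < L \<longrightarrow>
            torus_smooth (explicit_profiles r R L) \<and>
            torus_smooth_embedding Sym_mats (Gamma_map (explicit_profiles r R L)) \<and>
            cubically_saturating (explicit_profiles r R L))"
proof (rule conjI; intro allI impI; elim conjE)
  fix b :: "torus3 \<Rightarrow> real ^ 'm"
  assume b: "torus_smooth b" and "torus_smooth_embedding Sym_mats (Gamma_map b)"
  then have "torus_immersion (Gamma_map b)" by (simp add: torus_smooth_embedding_def)
  then show "4 \<le> CARD('m)" by (rule four_profiles_necessary[OF b])
next
  fix r R L :: real
  assume "0 < r" "r < R" "R + r < L"
  then show "torus_smooth (explicit_profiles r R L) \<and>
      torus_smooth_embedding Sym_mats (Gamma_map (explicit_profiles r R L)) \<and>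
      cubically_saturating (explicit_profiles r R L)"
    by (intro conjI torus_smooth_explicit explicit_embedding explicit_saturating)
qed

end
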